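(* Let $\Psi=\{\sigma_i\}_{i\in\mathbb N}$ and the random symmetric matrices $\mathbf A_n=\mathbf A_n(\Psi)$ satisfy Assumptions 1 to 5 of the context. Then, as $n\to\infty$, the empirical spectral distribution $\mathbf F_n(\cdot)$ of $\mathbf A_n$ converges weakly, almost surely, to a deterministic distribution function $F(\cdot)$, where $F(\cdot)$ is uniquely characterized by having the moments $m_k=\int_{-\infty}^{+\infty}x^k\,dF(x)$ given by $$m_{2s}=\sum_{(r_1,\ldots,r_s)\in\mathcal R_s}\frac{2}{s+1}\binom{s+1}{r_1,\ldots,r_s}\Lambda_1^{r_1}\Lambda_2^{r_2}\cdots\Lambda_s^{r_s}\quad (s\ge 1),\qquad m_{2s+1}=0\quad (s\ge 0),$$ where $\mathcal R_s=\{(r_1,\ldots,r_s)\in\mathbb N_0^s:\ \sum_{j=1}^s r_j=s+1,\ \sum_{j=1}^s j\,r_j=2s\}$. It is further true that, with probability one, $\mathbf F_n(\cdot)$ converges weakly to $F(\cdot)$ as $n\to\infty$.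
   Context: Notation: $\mathbb N=\{1,2,\ldots\}$, $\mathbb N_0=\{0\}\cup\mathbb N$, $[n]=\{1,\ldots,n\}$; $\binom{s+1}{r_1,\ldots,r_s}=\frac{(s+1)!}{r_1!\cdots r_s!}$. Model: $\Psi=\{\sigma_i:i\in\mathbb N\}$ is a sequence of positive reals. $\mathbf a_{ij}$, $1\le i\le j$, are independent real random variables on a common probability space, $\mathbf a_{ji}=\mathbf a_{ij}$, and $\mathbf A_n=(\mathbf a_{ij}/\sqrt n)_{i,j=1}^n$. Assumption 1: $\mathbb E\{\mathbf a_{ij}\}=0$ for all $i,j$. Assumption 2: there is a constant $K>0$ with $\mathbb P\{|\mathbf a_{ij}|<K\}=1$ for all $i,j$. Assumption 3: $\mathrm{Var}\{\mathbf a_{ij}\}=\sigma_i\sigma_j$ for all $i,j$. Assumption 4: with $\hat\sigma_n=\max_{i\in[n]}\sigma_i$ and $\check\sigma_n=\min_{i\in[n]}\sigma_i$, $\hat\sigma_n/\check\sigma_n=O(\log n)$. Assumption 5: the limits $\Lambda_k=\lim_{n\to\infty}\frac1n\sum_{i=1}^n\sigma_i^k$ exist for all $k\in\mathbb N$. Empirical spectral distribution: $\mathbf F_n(x)=\frac1n\,\mathrm{card}\{i\in[n]:\lambda_i(\mathbf A_n)\le x\}$, where $\lambda_1(\mathbf A_n)\le\cdots\le\lambda_n(\mathbf A_n)$ are the eigenvalues of $\mathbf A_n$. Modes of convergence: $\mathbf F_n$ converges weakly, almost surely, to $F$ if for every bounded continuous $f:\mathbb R\to\mathbb R$, $\int f\,d\mathbf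 F_n\to\int f\,dF$ almost surely. $\mathbf F_n$ converges weakly to $F$ with probability one if there is a measurable set $\mathcal S$ with $\mathbb P\{\mathcal S\}=1$ such that for every $\omega\in\mathcal S$ the realization of $\mathbf F_n$ at $\omega$ converges weakly to $F$. *)

theory Defs
  imports
    "HOL-Probability.Probability"
    "HOL-Library.Landau_Symbols"
    "Jordan_Normal_Form.Char_Poly"
begin

hide_const (open) Finite_Cartesian_Product.mat
unbundle no inner_syntax

text \<open>Distribution functions. Integrals \<open>\<integral> f dF\<close> are taken with respect to the
  Lebesgue--Stieltjes measure \<^const>\<open>interval_measure\<close>.\<close>

definition distribution_function :: "(real \<Rightarrow> real) \<Rightarrow> bool" where
  "distribution_function F \<longleftrightarrow>
     mono F \<and> (\<forall>x. continuous (at_right x) F) \<and>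
     (F \<longlongrightarrow> 0) at_bot \<and> (F \<longlongrightarrow> 1) at_top"

definition weakly_converges :: "(nat \<Rightarrow> real \<Rightarrow> real) \<Rightarrow> (real \<Rightarrow> real) \<Rightarrow> bool" where
  "weakly_converges Fs F \<longleftrightarrow>
     (\<forall>f :: real \<Rightarrow> real. continuous_on UNIV f \<and> bounded (range f) \<longrightarrow>
        (\<lambda>n. LINT x|interval_measure (Fs n). f x) \<longlonglongrightarrow> (LINT x|interval_measure F. f x))"

lemma distribution_function_real_distribution:
  assumes "distribution_function F"
  shows "real_distribution (interval_measure F)" "cdf (interval_measure F) = F"
  using assms unfolding distribution_function_def
  by (auto intro!: real_distribution_interval_measure cdf_interval_measure simp: mono_def)

text \<open>On distribution functions this is the pointwise notion \<^const>\<open>weak_conv\<close>.\<close>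

lemma weakly_converges_iff_weak_conv:
  assumes "\<And>n. distribution_function (Fs n)" "distribution_function F"
  shows "weakly_converges Fs F \<longleftrightarrow> weak_conv Fs F"
proof -
  have eq: "weak_conv Fs F = weak_conv_m (\<lambda>n. interval_measure (Fs n)) (interval_measure F)"
    by (simp add: weak_conv_m_def distribution_function_real_distribution assms)
  show ?thesis
  proof
    assume *: "weakly_converges Fs F"
    show "weak_conv Fs F" unfolding eq
    proof (rule integral_bdd_continuous_conv_imp_weak_conv)
      fix f :: "real \<Rightarrow> real"
      assume "\<And>x. isCont f x" "\<And>x. \<bar>f x\<bar> \<le> 1"
      then show "(\<lambda>n. integral\<^sup>L (interval_measure (Fs n)) f) \<longlonglongrightarrow> integral\<^sup>L (interval_measure F) f"
        using * unfolding weakly_converges_def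
        by (auto simp: continuous_on_eq_continuous_at bounded_iff)
    qed (auto intro: distribution_function_real_distribution assms)
  next
    assume "weak_conv Fs F"
    then have *: "weak_conv_m (\<lambda>n. interval_measure (Fs n)) (interval_measure F)"
      unfolding eq .
    show "weakly_converges Fs F" unfolding weakly_converges_def
    proof (intro allI impI)
      fix f :: "real \<Rightarrow> real"
      assume f: "continuous_on UNIV f \<and> bounded (range f)"
      then obtain B where "\<And>x. norm (f x) \<le> B" by (auto simp: bounded_iff)
      then show "(\<lambda>n. LINT x|interval_measure (Fs n). f x) \<longlonglongrightarrow> (LINT x|interval_measure F. f x)"
        using f
        by (intro weak_conv_imp_integral_bdd_continuous_conv[OF _ _ *, where B = B])
           (auto intro: distribution_function_real_distribution assms
                 simp: continuous_on_eq_continuous_at)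
    qed
  qed
qed

text \<open>The roots of the characteristic polynomial in increasing order, with multiplicity. The
  list has fewer than \<open>n\<close> entries if an \<open>n \<times> n\<close> matrix has non-real eigenvalues; for
  symmetric matrices its length is \<open>n\<close> (\<open>length_eigenvalues_symmetric\<close>).\<close>

definition eigenvalues :: "real mat \<Rightarrow> real list" where
  "eigenvalues A = sorted_list_of_multiset (proots (char_poly A))"

definition esd :: "real mat \<Rightarrow> real \<Rightarrow> real" where
  "esd A x = real (card {i \<in> {1..dim_row A}. eigenvalues A ! (i - 1) \<le> x}) / real (dim_row A)"

lemma distribution_function_esd:
  assumes "dim_row A > 0"
  shows "distribution_function (esd A)"
proof -
  define n where "n = dim_row A"
  define e where "e i = eigenvalues A ! (i - 1)" for i
  define h where "h i x = (if e i \<le> x then 1 else 0 :: real)" for i x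
  have n: "n > 0" using assms by (simp add: n_def)
  have esd: "esd A = (\<lambda>x. (\<Sum>i=1..n. h i x) / real n)"
    by (auto simp: esd_def n_def h_def e_def sum.If_cases Int_def fun_eq_iff)
  have "(h i \<longlongrightarrow> h i x) (at_right x)" for i x
  proof (rule tendsto_eventually, cases "e i \<le> x")
    case True
    show "\<forall>\<^sub>F y in at_right x. h i y = h i x"
      using True eventually_at_right_less[of x] by (auto elim!: eventually_mono simp: h_def)
  next
    case False
    then show "\<forall>\<^sub>F y in at_right x. h i y = h i x"
      using eventually_at_right_real[of x "e i"] by (auto elim!: eventually_mono simp: h_def)
  qed
  moreover have "(h i \<longlongrightarrow> 1) at_top" for i
    by (rule tendsto_eventually) (auto simp: h_def eventually_at_top_linorder)
  moreover have "(h i \<longlongrightarrow> 0) at_bot" for i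
    using eventually_at_bot_dense[of "\<lambda>x. h i x = 0"]
    by (intro tendsto_eventually) (auto simp: h_def intro!: exI[of _ "e i"])
  ultimately have "((\<lambda>x. (\<Sum>i=1..n. h i x) / real n) \<longlongrightarrow> (\<Sum>i=1..n. h i x) / real n) (at_right x)"
      "((\<lambda>x. (\<Sum>i=1..n. h i x) / real n) \<longlongrightarrow> (\<Sum>i=1..n. 0) / real n) at_bot"
      "((\<lambda>x. (\<Sum>i=1..n. h i x) / real n) \<longlongrightarrow> (\<Sum>i=1..n. 1) / real n) at_top" for x
    using n by (intro tendsto_divide tendsto_sum tendsto_const; simp)+
  moreover have "mono (\<lambda>x. (\<Sum>i=1..n. h i x) / real n)"
    by (intro monoI divide_right_mono sum_mono) (auto simp: h_def)
  ultimately show ?thesis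
    using n unfolding esd distribution_function_def continuous_within by simp
qed

text \<open>Random variables are indexed from 1, matrix entries in \<^typ>\<open>'a mat\<close> from 0.\<close>

definition scaled_matrix :: "(nat \<Rightarrow> nat \<Rightarrow> 'w \<Rightarrow> real) \<Rightarrow> nat \<Rightarrow> 'w \<Rightarrow> real mat" where
  "scaled_matrix a n \<omega> = Matrix.mat n n (\<lambda>(i, j). a (Suc i) (Suc j) \<omega> / sqrt (real n))"

text \<open>The tuples \<open>(r\<^sub>1, \<dots>, r\<^sub>s)\<close> are extensional functions on \<open>{1..s}\<close>.\<close>

definition R_set :: "nat \<Rightarrow> (nat \<Rightarrow> nat) set" where
  "R_set s = {r \<in> {1..s} \<rightarrow>\<^sub>E UNIV. (\<Sum>j=1..s. r j) = s + 1 \<and> (\<Sum>j=1..s. j * r j) = 2 * s}"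

lemma finite_R_set: "finite (R_set s)"
proof (rule finite_subset)
  show "R_set s \<subseteq> {1..s} \<rightarrow>\<^sub>E {..s + 1}"
  proof
    fix r assume r: "r \<in> R_set s"
    have "r j \<le> s + 1" if "j \<in> {1..s}" for j
      using r member_le_sum[of j "{1..s}" r] that by (auto simp: R_set_def)
    with r show "r \<in> {1..s} \<rightarrow>\<^sub>E {..s + 1}"
      by (auto simp: R_set_def PiE_iff)
  qed
qed (auto intro: finite_PiE)

definition multinomial :: "nat \<Rightarrow> (nat \<Rightarrow> nat) \<Rightarrow> real" where
  "multinomial s r = fact (s + 1) / (\<Prod>j=1..s. fact (r j))"

definition even_moment :: "(nat \<Rightarrow> real) \<Rightarrow> nat \<Rightarrow> real" where
  "even_moment \<Lambda> s =
     (\<Sum>r\<in>R_set s. 2 / (real s + 1) * multinomial s r * (\<Prod>j=1..s. \<Lambda> j ^ r j))"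

definition has_limit_moments :: "(nat \<Rightarrow> real) \<Rightarrow> (real \<Rightarrow> real) \<Rightarrow> bool" where
  "has_limit_moments \<Lambda> F \<longleftrightarrow>
     (\<forall>k. integrable (interval_measure F) (\<lambda>x. x ^ k)) \<and>
     (\<forall>s\<ge>1. (LINT x|interval_measure F. x ^ (2 * s)) = even_moment \<Lambda> s) \<and>
     (\<forall>s. (LINT x|interval_measure F. x ^ (2 * s + 1)) = 0)"

lemma symmetric_eigenvalue_real:
  fixes A :: "real mat"
  assumes A: "A \<in> carrier_mat n n" and sym: "transpose_mat A = A"
    and ev: "eigenvalue (map_mat complex_of_real A) \<mu>"
  shows "\<mu> \<in> \<real>"
proof -
  let ?C = "map_mat complex_of_real A"
  have C: "?C \<in> carrier_mat n n" using A by simp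
  from ev obtain v where v: "v \<in> carrier_vec n" "v \<noteq> 0\<^sub>v n" "?C *\<^sub>v v = \<mu> \<cdot>\<^sub>v v"
    using C by (auto simp: eigenvalue_def eigenvector_def)
  have symC: "transpose_mat ?C = ?C"
    using sym by (metis map_mat_transpose)
  have conj: "?C *\<^sub>v conjugate v = conjugate (?C *\<^sub>v v)"
    using A v(1) by (intro eq_vecI) (auto simp: scalar_prod_def)
  have cv: "conjugate v \<in> carrier_vec n" using v(1) by simp
  have "\<mu> * (v \<bullet>c v) = (?C *\<^sub>v v) \<bullet> conjugate v"
    using v(1) cv by (simp add: v(3))
  also have "\<dots> = conjugate v \<bullet> (?C *\<^sub>v v)"
    using C v(1) cv by (intro comm_scalar_prod[of _ n]) auto
  also have "\<dots> = (transpose_mat ?C *\<^sub>v conjugate v) \<bullet> v"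
    using transpose_vec_mult_scalar[OF C v(1) cv] by simp
  also have "\<dots> = conjugate (\<mu> \<cdot>\<^sub>v v) \<bullet> v"
    by (simp only: symC conj v(3))
  also have "\<dots> = cnj \<mu> * (v \<bullet>c v)"
    using v(1) cv comm_scalar_prod[OF v(1) cv] by (simp add: conjugate_smult_vec)
  finally have "\<mu> * (v \<bullet>c v) = cnj \<mu> * (v \<bullet>c v)" .
  moreover have "v \<bullet>c v \<noteq> 0" using v by (simp add: conjugate_square_eq_0_vec)
  ultimately have "\<mu> = cnj \<mu>" by simp
  then show ?thesis by (metis Reals_cnj_iff)
qed

lemma char_poly_symmetric:
  fixes A :: "real mat"
  assumes A: "A \<in> carrier_mat n n" and sym: "transpose_mat A = A"
  shows "char_poly A = (\<Prod>e\<leftarrow>eigenvalues A. [:- e, 1:])" "length (eigenvalues A) = n"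
proof -
  interpret h: map_poly_inj_idom_hom complex_of_real ..
  let ?C = "map_mat complex_of_real A"
  have C: "?C \<in> carrier_mat n n" using A by simp
  obtain as where as: "char_poly ?C = (\<Prod>a\<leftarrow>as. [:- a, 1:])" "length as = n"
    using char_poly_factorized[OF C] by auto
  have "a \<in> \<real>" if "a \<in> set as" for a
  proof (rule symmetric_eigenvalue_real[OF A sym])
    show "eigenvalue ?C a"
      unfolding eigenvalue_root_char_poly[OF C] as(1)
      using that by (auto simp: poly_prod_list prod_list_zero_iff image_iff intro!: bexI[of _ a])
  qed
  then have "map (\<lambda>a. [:- a, 1:]) as = map (\<lambda>a. map_poly complex_of_real [:- Re a, 1:]) as"
    by (intro map_cong refl) (auto elim!: Reals_cases)
  then have "char_poly ?C = (\<Prod>a\<leftarrow>as. map_poly complex_of_real [:- Re a, 1:])"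
    unfolding as(1) by (rule arg_cong)
  also have "\<dots> = map_poly complex_of_real (\<Prod>a\<leftarrow>as. [:- Re a, 1:])"
    unfolding h.hom_prod_list map_map comp_def ..
  finally have "map_poly complex_of_real (char_poly A) =
      map_poly complex_of_real (\<Prod>a\<leftarrow>as. [:- Re a, 1:])"
    by (simp only: of_real_hom.char_poly_hom[OF A])
  then have p: "char_poly A = (\<Prod>a\<leftarrow>as. [:- Re a, 1:])" by (rule h.injectivity)
  have "proots (\<Prod>a\<leftarrow>as. [:- Re a, 1:]) = mset (map Re as)" for as
  proof (induction as)
    case (Cons b bs)
    have "(\<Prod>a\<leftarrow>bs. [:- Re a, 1:]) \<noteq> 0" by (auto simp: prod_list_zero_iff)
    with Cons show ?case by (simp add: proots_mult del: mult_pCons_left)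
  qed simp
  then have m: "mset (eigenvalues A) = mset (map Re as)"
    by (simp add: eigenvalues_def p)
  then show "length (eigenvalues A) = n" using as(2) by (metis length_map size_mset)
  have "char_poly A = prod_mset (image_mset (\<lambda>e. [:- e, 1:]) (mset (map Re as)))"
    by (simp add: p prod_mset_prod_list[symmetric] multiset.map_comp comp_def del: mset_map)
       (simp add: mset_map[symmetric] comp_def prod_mset_prod_list del: mset_map)
  also have "\<dots> = (\<Prod>e\<leftarrow>eigenvalues A. [:- e, 1:])"
    unfolding m[symmetric] by (simp add: mset_map[symmetric] prod_mset_prod_list del: mset_map)
  finally show "char_poly A = (\<Prod>e\<leftarrow>eigenvalues A. [:- e, 1:])" .
qed

lemmas length_eigenvalues_symmetric = char_poly_symmetric(2)

end

theory Submission
  imports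
    Defs
    "HOL-Combinatorics.Multiset_Permutations"
    "Jordan_Normal_Form.Schur_Decomposition"
begin

text \<open>
  The proof is by the method of moments. The expected normalized trace of a power of the matrix is
  a sum over closed walks on \<open>{1..n}\<close>; a walk using some edge only once contributes nothing, and
  by counting vertices only walks that run around a tree and use each of its edges exactly twice
  survive in the limit. Cutting such a walk at its first edge splits it into two
  vertex-disjoint walks of the same kind. This gives a recursion for the limiting moments, which
  Lagrange inversion solves in the form stated. Two closed walks sharing an edge, with every edge
  used at least twice in total, meet at most as many vertices as either has steps, so the variance
  of the normalized trace is \<open>O(n\<^sup>-\<^sup>2)\<close> and Borel--Cantelli yields almost sure convergence of all
  moments. Since \<open>\<sigma>\<^sub>i\<^sup>2\<close> is a variance of an entry bounded by \<open>K\<close>, one has \<open>\<sigma>\<^sub>i \<le> K\<close>, so the limiting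
  moments grow at most geometrically; hence they belong to a unique, compactly supported
  distribution, and convergence of moments implies weak convergence.
\<close>

section \<open>Walks and vertex counts\<close>

text \<open>The weight of a tree walk is the product of \<open>\<sigma> x\<close> to the power of
  the degree of x, so the sum over tree walks does not factor when an edge is cut: the degrees of
  both endpoints change. The recursion therefore carries a spare power \<open>h\<close> of
  \<open>\<sigma>\<close> at the root. Cutting the first edge leaves one factor at the root of the
  branch and one more at the old root, which explains the orders 1 and \<open>Suc h\<close>.
  Disjointness of the two pieces couples them as well, but giving it up costs only a lower power of
  n. The limit law is not built from its moments. Tightness along a single sample point yields it as
  a subsequential limit; a polynomial approximation that does not depend on the sequence of laws
  then gives both convergence along the other sample points and uniqueness. Both assertions about
  convergence rest on one event, on which the countably many moments converge; the test function is
  chosen afterwards.\<close>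

definition edge :: "nat \<Rightarrow> nat \<Rightarrow> nat \<times> nat" where
  "edge x y = (min x y, max x y)"

fun wedges :: "nat list \<Rightarrow> (nat \<times> nat) list" where
  "wedges (x # y # w) = edge x y # wedges (y # w)"
| "wedges w = []"

text \<open>A list that is not heavy contains some edge exactly once. The product of the
  corresponding independent centred entries then has expectation zero.\<close>

definition heavy :: "'a list \<Rightarrow> bool" where
  "heavy L \<longleftrightarrow> (\<forall>e\<in>set L. count_list L e \<ge> 2)"

lemma edge_commute: "edge x y = edge y x"
  by (simp add: edge_def min.commute max.commute)

lemma edge_eq_iff: "edge x y = edge u v \<longleftrightarrow> x = u \<and> y = v \<or> x = v \<and> y = u"
  by (auto simp: edge_def min_def max_def)

lemma edge_mem_Times: "edge x y \<in> S \<times> S \<longleftrightarrow> x \<in> S \<and> y \<in> S"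
  by (auto simp: edge_def min_def max_def)

lemma length_wedges: "length (wedges w) = length w - 1"
  by (induction w rule: wedges.induct) auto

lemma wedges_Cons: "w \<noteq> [] \<Longrightarrow> wedges (x # w) = edge x (hd w) # wedges w"
  by (cases w) auto

lemma wedges_append:
  "p \<noteq> [] \<Longrightarrow> q \<noteq> [] \<Longrightarrow> wedges (p @ q) = wedges p @ edge (last p) (hd q) # wedges q"
  by (induction p rule: wedges.induct) (auto simp: wedges_Cons)

lemma wedges_subset: "set (wedges w) \<subseteq> set w \<times> set w"
  by (induction w rule: wedges.induct) (auto simp: edge_mem_Times edge_def min_def max_def)

lemma wedges_ordered: "(i, j) \<in> set (wedges w) \<Longrightarrow> i \<le> j"
  by (induction w rule: wedges.induct) (auto simp: edge_def)

lemma wedges_splitE: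
  assumes "wedges w = L1 @ e # L2"
  obtains p q where "w = p @ q" "p \<noteq> []" "q \<noteq> []" "wedges p = L1" "wedges q = L2"
    "edge (last p) (hd q) = e"
proof -
  have "\<exists>p q. w = p @ q \<and> p \<noteq> [] \<and> q \<noteq> [] \<and> wedges p = L1 \<and> wedges q = L2 \<and>
      edge (last p) (hd q) = e"
    using assms
  proof (induction w arbitrary: L1 rule: wedges.induct)
    case (1 x y w)
    show ?case
    proof (cases L1)
      case Nil
      with 1 show ?thesis by (intro exI[of _ "[x]"] exI[of _ "y # w"]) auto
    next
      case (Cons f L)
      with 1 obtain p q where "y # w = p @ q" "p \<noteq> []" "q \<noteq> []" "wedges p = L"
        "wedges q = L2" "edge (last p) (hd q) = e" by auto
      with Cons 1 show ?thesis
        by (intro exI[of _ "x # p"] exI[of _ q]) (auto simp: wedges_Cons hd_append)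
    qed
  qed auto
  with that show thesis by blast
qed

lemma card_set_le_wedges: "w \<noteq> [] \<Longrightarrow> card (set w) \<le> card (set (wedges w)) + 1"
proof (induction w rule: wedges.induct)
  case (1 x y w)
  show ?case
  proof (cases "x \<in> set (y # w)")
    case True
    then have "card (set (x # y # w)) = card (set (y # w))" by (simp add: insert_absorb)
    also have "\<dots> \<le> card (set (wedges (y # w))) + 1" using 1 by simp
    also have "\<dots> \<le> card (set (wedges (x # y # w))) + 1"
      by (intro add_right_mono card_mono) auto
    finally show ?thesis .
  next
    case False
    then have "edge x y \<notin> set (wedges (y # w))"
      using wedges_subset[of "y # w"] edge_mem_Times[of x y "set (y # w)"] by blast
    with 1 False show ?thesis by simp
  qed
qed auto

text \<open>The same count with all of S regarded as visited: a vertex outside S is charged to an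
  edge that does not lie inside S. Since the walk meets S, the extra 1 disappears.\<close>

lemma card_new_vertices_le:
  assumes "set w \<inter> S \<noteq> {}"
  shows "card (set w - S) \<le> card (set (wedges w) - S \<times> S)"
  using assms
proof (induction w rule: wedges.induct)
  case (1 x y w)
  let ?w = "y # w"
  show ?case
  proof (cases "set ?w \<inter> S = {}")
    case False
    then have IH: "card (set ?w - S) \<le> card (set (wedges ?w) - S \<times> S)" by (rule 1)
    show ?thesis
    proof (cases "x \<in> S \<union> set ?w")
      case True
      then have "set (x # ?w) - S = set ?w - S" by auto
      then have "card (set (x # ?w) - S) = card (set ?w - S)" by simp
      also note IH
      also have "card (set (wedges ?w) - S \<times> S) \<le> card (set (wedges (x # ?w)) - S \<times> S)"
        by (intro card_mono) auto
      finally show ?thesis .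
    next
      case x: False
      then have "edge x y \<notin> set (wedges ?w)"
        using wedges_subset[of ?w] edge_mem_Times[of x y "set ?w"] by blast
      moreover have "edge x y \<notin> S \<times> S" using x by (simp add: edge_mem_Times)
      moreover have "set (x # ?w) - S = insert x (set ?w - S)" using x by auto
      moreover have "set (wedges (x # ?w)) - S \<times> S =
          insert (edge x y) (set (wedges ?w) - S \<times> S)"
        using \<open>edge x y \<notin> S \<times> S\<close> by (simp add: insert_Diff_if)
      ultimately show ?thesis using x IH by simp
    qed
  next
    \<comment> \<open>Only the first vertex lies in S. The rest avoids S and is bounded by
      \<open>card_set_le_wedges\<close>, whose extra vertex is paid for by the edge leaving
      S.\<close>
    case True
    then have x: "x \<in> S" and y: "y \<notin> S" using 1(2) by auto
    have D: "set (wedges ?w) \<inter> S \<times> S = {}" using wedges_subset[of ?w] True by blast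
    have "set (x # ?w) - S = set ?w" using x True by auto
    moreover have "edge x y \<notin> set (wedges ?w)"
      using wedges_subset[of ?w] x True edge_mem_Times[of x y "set ?w"] by blast
    moreover have "edge x y \<notin> S \<times> S" using y by (simp add: edge_mem_Times)
    then have "set (wedges (x # ?w)) - S \<times> S = insert (edge x y) (set (wedges ?w))"
      using D by (simp add: insert_Diff_if Diff_triv)
    ultimately show ?thesis using card_set_le_wedges[of ?w] by simp
  qed
next
  case ("2_2" v)
  then have "set [v] - S = {}" by auto
  then show ?case by (metis card.empty le0)
qed auto

text \<open>The edges of p lie inside \<open>set p\<close>, while the new vertices of q are charged
  to edges that do not, so no edge is charged twice.\<close>

lemma card_Un_le_wedges:
  assumes "set p \<inter> set q \<noteq> {}"
  shows "card (set p \<union> set q) \<le> card (set (wedges p) \<union> set (wedges q)) + 1"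
proof -
  have "card (set p \<union> set q) = card (set p) + card (set q - set p)"
    using card_Un_disjoint[of "set p" "set q - set p"] by (simp add: Un_Diff_cancel)
  also have "\<dots> \<le> (card (set (wedges p)) + 1) + card (set (wedges q) - set p \<times> set p)"
    using assms by (intro add_mono card_set_le_wedges card_new_vertices_le) auto
  also have "\<dots> = card (set (wedges p) \<union> (set (wedges q) - set p \<times> set p)) + 1"
    using wedges_subset[of p] by (subst card_Un_disjoint) auto
  also have "\<dots> \<le> card (set (wedges p) \<union> set (wedges q)) + 1"
    by (intro add_right_mono card_mono) auto
  finally show ?thesis .
qed

section \<open>Edge multiplicities and walks around trees\<close>

lemma heavy_card:
  assumes "heavy L"
  shows "2 * card (set L) \<le> length L"
proof -
  have "2 * card (set L) = (\<Sum>e\<in>set L. 2)" by simp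
  also have "\<dots> \<le> (\<Sum>e\<in>set L. count_list L e)"
    using assms unfolding heavy_def by (intro sum_mono) auto
  also have "\<dots> = length L" by (rule sum_count_set) auto
  finally show ?thesis .
qed

text \<open>Equality in \<open>heavy_card\<close> leaves no room for a third use of any
  edge.\<close>

lemma heavy_card_eq:
  assumes "heavy L" "2 * card (set L) \<ge> length L" "e \<in> set L"
  shows "count_list L e = 2"
proof (rule ccontr)
  assume "count_list L e \<noteq> 2"
  with assms have "count_list L e > 2" by (force simp: heavy_def)
  then have "(\<Sum>e\<in>set L. 2) < (\<Sum>e\<in>set L. count_list L e)"
    using assms unfolding heavy_def by (intro sum_strict_mono_ex1) auto
  also have "\<dots> = length L" by (rule sum_count_set) auto
  finally show False using assms by simp
qed

text \<open>By \<open>heavy_walk_card\<close> below, the number of vertices is then maximal: the walk runs around a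
  tree and uses each edge exactly twice.\<close>

definition good :: "nat list \<Rightarrow> bool" where
  "good w \<longleftrightarrow> w \<noteq> [] \<and> hd w = last w \<and> heavy (wedges w) \<and> 2 * card (set w) = length w + 1"

lemma heavy_walk_card: "w \<noteq> [] \<Longrightarrow> heavy (wedges w) \<Longrightarrow> 2 * card (set w) \<le> length w + 1"
  using heavy_card[of "wedges w"] card_set_le_wedges[of w] length_wedges[of w]
  by (cases w) auto

text \<open>The first edge \<open>{x, y}\<close> is used exactly once more. Cutting both uses leaves two pieces; if
  they shared a vertex, or if the edge were used twice in the same direction, the remaining edges
  would be too few to connect all the vertices.\<close>

lemma goodE:
  assumes "good w" "length w > 1"
  obtains x p q where "w = x # p @ q" "good p" "good q" "hd q = x" "set p \<inter> set q = {}"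
proof -
  from assms obtain x y r where w: "w = x # y # r"
    by (metis One_nat_def hd_Cons_tl length_Cons less_irrefl_nat less_nat_zero_code
        list.size(3))
  let ?e = "edge x y"
  have hv: "heavy (wedges w)" and hl: "last w = x" and cw: "2 * card (set w) = length w + 1"
    using assms w by (auto simp: good_def)
  have c2: "count_list (wedges w) e = 2" if "e \<in> set (wedges w)" for e
    using heavy_card_eq[OF hv _ that] card_set_le_wedges[of w] cw w length_wedges[of w] by simp
  have "count_list (wedges (y # r)) ?e = 1" using c2[of ?e] by (simp add: w)
  then have "?e \<in> set (wedges (y # r))" by (metis count_notin zero_neq_one)
  then obtain L1 L2 where L: "wedges (y # r) = L1 @ ?e # L2" by (meson split_list)
  then obtain p q where pq: "y # r = p @ q" "p \<noteq> []" "q \<noteq> []" "wedges p = L1"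
    "wedges q = L2" "edge (last p) (hd q) = ?e" by (rule wedges_splitE)
  have we: "wedges w = ?e # wedges p @ ?e # wedges q" unfolding w wedges.simps(1) L pq(4,5) ..
  have hp: "hd p = y" using pq by (metis hd_append2 list.sel(1))
  have lq: "last q = x" using hl pq w by (metis last_ConsR last_appendR list.discI)
  have sw: "set w = set p \<union> set q"
  proof -
    have "x \<in> set q" using lq pq last_in_set by blast
    then show ?thesis using w pq by (metis UnCI insert_absorb list.simps(15) set_append)
  qed
  have cnt: "count_list (wedges p) e + count_list (wedges q) e = 2"
    if "e \<in> set (wedges p) \<union> set (wedges q)" "e \<noteq> ?e" for e
    using c2[of e] that by (auto simp: we)
  have en: "?e \<notin> set (wedges p)" "?e \<notin> set (wedges q)"
    using c2[of ?e] by (auto simp: we count_list_0_iff)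
  have disj: "set p \<inter> set q = {}"
  proof (rule ccontr)
    assume "set p \<inter> set q \<noteq> {}"
    \<comment> \<open>Of the \<open>length w - 1\<close> steps, two use \<open>?e\<close>; the
      others use at most (length w - 3) / 2 edges. These would connect at most (length w - 1) / 2
      vertices, one fewer than w has.\<close>
    from card_Un_le_wedges[OF this]
    have "card (set w) \<le> card (set (wedges p @ wedges q)) + 1" by (simp add: sw)
    moreover have "heavy (wedges p @ wedges q)"
      using cnt en by (auto simp: heavy_def) force+
    from heavy_card[OF this] have "2 * card (set (wedges p @ wedges q)) \<le> length w - 3"
      using length_wedges[of p] length_wedges[of q] w
      by (simp add: arg_cong[OF pq(1), of length, simplified] pq(2,3) le_diff_conv
          del: pq(4,5)) (use pq(2,3) in \<open>cases p; cases q; simp\<close>)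
    moreover have "length w \<ge> 3"
      using arg_cong[OF pq(1), of length] pq(2,3) w by (cases p; cases q) auto
    ultimately show False using cw by linarith
  qed
  \<comment> \<open>The vertex x ends q and so is absent from p; hence the second use of
    \<open>?e\<close> leads from y back to x.\<close>
  have "last p \<noteq> x" using disj lq pq by (metis disjoint_iff last_in_set)
  then have lp: "last p = y" and hq: "hd q = x" using pq(6) by (auto simp: edge_eq_iff)
  have hvp: "heavy (wedges p)" unfolding heavy_def
  proof
    fix e assume e: "e \<in> set (wedges p)"
    then have "e \<notin> set (wedges q)" using wedges_subset[of p] wedges_subset[of q] disj by blast
    then show "2 \<le> count_list (wedges p) e" using cnt[of e] e en by (cases "e = ?e") auto
  qed
  have hvq: "heavy (wedges q)" unfolding heavy_def
  proof
    fix e assume e: "e \<in> set (wedges q)"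
    then have "e \<notin> set (wedges p)" using wedges_subset[of p] wedges_subset[of q] disj by blast
    then show "2 \<le> count_list (wedges q) e" using cnt[of e] e en by (cases "e = ?e") auto
  qed
  have "card (set w) = card (set p) + card (set q)" using sw disj by (simp add: card_Un_disjoint)
  moreover have "length w = length p + length q + 1"
    using arg_cong[OF pq(1), of length] w by simp
  \<comment> \<open>The bounds of \<open>heavy_walk_card\<close> for p and q add up to the equality
    known for w, so both are attained.\<close>
  ultimately have "2 * card (set p) = length p + 1" "2 * card (set q) = length q + 1"
    using heavy_walk_card[OF pq(2) hvp] heavy_walk_card[OF pq(3) hvq] cw by auto
  then have "good p" "good q" using hp lp hq lq hvp hvq pq by (auto simp: good_def)
  with that w pq hq disj show thesis by blast
qed

text \<open>Converse of \<open>goodE\<close>: step from the root of q to the root of p, run around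
  p, step back, run around q.\<close>

lemma good_join:
  assumes "good p" "good q" "set p \<inter> set q = {}"
  shows "good (hd q # p @ q)"
    and "wedges (hd q # p @ q) = edge (hd q) (hd p) # wedges p @ edge (hd q) (hd p) # wedges q"
proof -
  have ne: "p \<noteq> []" "q \<noteq> []" "hd p = last p" "hd q = last q" using assms by (auto simp: good_def)
  show we: "wedges (hd q # p @ q) = edge (hd q) (hd p) # wedges p @ edge (hd q) (hd p) # wedges q"
    using ne by (simp add: wedges_Cons wedges_append edge_commute)
  have "heavy (wedges (hd q # p @ q))"
    using assms unfolding we by (force simp: heavy_def good_def)
  moreover have "set (hd q # p @ q) = set p \<union> set q" using ne by auto
  then have "card (set (hd q # p @ q)) = card (set p) + card (set q)"
    using assms by (simp add: card_Un_disjoint)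
  ultimately show "good (hd q # p @ q)"
    using assms ne by (auto simp: good_def)
qed

lemma good_odd_length: "good w \<Longrightarrow> odd (length w)"
  unfolding good_def by (metis even_plus_one_iff dvd_triv_left)

text \<open>An edge used once by a closed walk is no bridge: rotate the walk to start just after
  this use and stop just before it.\<close>

lemma walk_cut_edge:
  assumes "w \<noteq> []" "hd w = last w" "count_list (wedges w) e = 1"
  obtains u where "set u = set w" "set (wedges u) = set (wedges w) - {e}"
proof -
  have "e \<in> set (wedges w)" using assms by (metis count_notin zero_neq_one)
  then obtain L1 L2 where L: "wedges w = L1 @ e # L2" by (meson split_list)
  then obtain p q where pq: "w = p @ q" "p \<noteq> []" "q \<noteq> []" "wedges p = L1"
    "wedges q = L2" "edge (last p) (hd q) = e" by (rule wedges_splitE)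
  have lq: "last q = hd p" using assms pq by simp
  have en: "e \<notin> set L1" "e \<notin> set L2" using assms(3) by (auto simp: L count_list_0_iff)
  obtain h t where p: "p = h # t" using pq by (cases p) auto
  show thesis
  \<comment> \<open>The list q already ends at h, the first vertex of p, so only the tail t is
    appended.\<close>
  proof (rule that[of "q @ t"])
    show "set (q @ t) = set w" using pq lq p last_in_set[of q] by auto
    show "set (wedges (q @ t)) = set (wedges w) - {e}"
    proof (cases "t = []")
      case True
      with p pq have "L1 = []" by auto
      with L pq en True show ?thesis by auto
    next
      case False
      have "set (wedges (q @ t)) = set (wedges q) \<union> set (wedges p)"
        using False pq p lq by (auto simp: wedges_append wedges_Cons)
      with L pq en show ?thesis by auto
    qed
  qed
qed

text \<open>There are at most k distinct edges, which by itself allows k + 1 vertices. If there are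
  exactly k, a shared edge is used once by each walk; both can be opened there without losing
  vertices, so k - 1 edges still connect everything. Against the normalization n^(k+2) this makes
  the variance of order n^-2.\<close>

lemma card_pair_walks_le:
  assumes "w \<noteq> []" "hd w = last w" "length w = k + 1"
    and "w' \<noteq> []" "hd w' = last w'" "length w' = k + 1"
    and hv: "heavy (wedges w @ wedges w')"
    and sh: "set (wedges w) \<inter> set (wedges w') \<noteq> {}"
  shows "card (set w \<union> set w') \<le> k"
proof -
  let ?E = "set (wedges w) \<union> set (wedges w')"
  obtain e where e: "e \<in> set (wedges w)" "e \<in> set (wedges w')" using sh by auto
  have V: "set w \<inter> set w' \<noteq> {}"
    using e wedges_subset[of w] wedges_subset[of w'] by blast
  have le: "2 * card ?E \<le> 2 * k"
    using heavy_card[OF hv] assms by (simp add: length_wedges)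
  show ?thesis
  proof (cases "card ?E = k")
    case False
    with le card_Un_le_wedges[OF V] show ?thesis by linarith
  next
    case True
    have "count_list (wedges w @ wedges w') e = 2"
      using heavy_card_eq[OF hv] True e assms by (simp add: length_wedges)
    moreover have "count_list (wedges w) e \<noteq> 0" "count_list (wedges w') e \<noteq> 0"
      using e by (auto simp: count_list_0_iff)
    ultimately have c: "count_list (wedges w) e = 1" "count_list (wedges w') e = 1" by auto
    obtain u where u: "set u = set w" "set (wedges u) = set (wedges w) - {e}"
      using walk_cut_edge[OF assms(1,2) c(1)] .
    obtain u' where u': "set u' = set w'" "set (wedges u') = set (wedges w') - {e}"
      using walk_cut_edge[OF assms(4,5) c(2)] .
    have "card (set u \<union> set u') \<le> card (set (wedges u) \<union> set (wedges u')) + 1"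
      using V u u' by (intro card_Un_le_wedges) auto
    also have "set (wedges u) \<union> set (wedges u') = ?E - {e}" using u u' by auto
    also have "card (?E - {e}) + 1 = k"
      using True e by (simp add: card_Diff_singleton) (metis One_nat_def Suc_pred Un_iff card_gt_0_iff empty_iff finite_UnI finite_set)
    finally show ?thesis using u u' by simp
  qed
qed

text \<open>Such a list is determined by a list of \<open>v\<close> values and the pattern in which they occur.\<close>

lemma card_lists_few_values:
  assumes "n > 0"
  shows "card {w. set w \<subseteq> {1..n} \<and> length w = L \<and> card (set w) \<le> v} \<le> v ^ L * n ^ v"
proof -
  let ?A = "{u. set u \<subseteq> {1..n} \<and> length u = v} \<times> {f. set f \<subseteq> {..<v} \<and> length f = L}"
  have fin: "finite ?A" by (intro finite_cartesian_product finite_lists_length_eq) auto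
  have "{w. set w \<subseteq> {1..n} \<and> length w = L \<and> card (set w) \<le> v} \<subseteq>
      (\<lambda>(u, f). map (\<lambda>i. u ! i) f) ` ?A"
  proof
    fix w assume w: "w \<in> {w. set w \<subseteq> {1..n} \<and> length w = L \<and> card (set w) \<le> v}"
    obtain d where d: "set d = set w" "distinct d" using finite_distinct_list[of "set w"] by auto
    \<comment> \<open>Padding with the vertex 1, available as n > 0, makes the length of the value
      list independent of w.\<close>
    define u where "u = d @ replicate (v - length d) 1"
    have "length d \<le> v" using w d distinct_card[of d] by auto
    then have u: "length u = v" "set u \<subseteq> {1..n}" "set w \<subseteq> set u"
      using w d assms by (auto simp: u_def)
    have "\<forall>x\<in>set w. \<exists>i<v. u ! i = x" using u by (metis in_set_conv_nth subsetD)
    then obtain g where g: "\<And>x. x \<in> set w \<Longrightarrow> g x < v \<and> u ! g x = x" by metis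
    have "w = map (\<lambda>i. u ! i) (map g w)" using g by (simp add: map_idI)
    moreover have "set (map g w) \<subseteq> {..<v}" "length (map g w) = L" using g w by auto
    ultimately show "w \<in> (\<lambda>(u, f). map (\<lambda>i. u ! i) f) ` ?A"
      using u by (intro image_eqI[of _ _ "(u, map g w)"]) auto
  qed
  then have "card {w. set w \<subseteq> {1..n} \<and> length w = L \<and> card (set w) \<le> v} \<le> card ?A"
    using fin by (meson card_image_le card_mono finite_imageI order_trans)
  also have "\<dots> = v ^ L * n ^ v"
    by (simp add: card_cartesian_product card_lists_length_eq mult.commute)
  finally show ?thesis .
qed

section \<open>Traces of powers and the empirical spectral distribution\<close>

definition mat_trace :: "'a :: comm_ring_1 mat \<Rightarrow> 'a" where
  "mat_trace A = (\<Sum>i<dim_row A. A $$ (i, i))"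

lemma mat_trace_mult_commute:
  fixes A B :: "'a :: comm_ring_1 mat"
  assumes "A \<in> carrier_mat n m" "B \<in> carrier_mat m n"
  shows "mat_trace (A * B) = mat_trace (B * A)"
proof -
  have "mat_trace (A * B) = (\<Sum>i<n. \<Sum>j<m. A $$ (i, j) * B $$ (j, i))"
    using assms unfolding mat_trace_def by (simp add: scalar_prod_def atLeast0LessThan)
  also have "\<dots> = (\<Sum>j<m. \<Sum>i<n. A $$ (i, j) * B $$ (j, i))" by (rule sum.swap)
  also have "\<dots> = mat_trace (B * A)"
    using assms unfolding mat_trace_def by (simp add: scalar_prod_def atLeast0LessThan mult.commute)
  finally show ?thesis .
qed

lemma upper_triangular_pow:
  fixes B :: "'a :: comm_ring_1 mat"
  assumes B: "B \<in> carrier_mat n n" and U: "upper_triangular B"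
  shows "upper_triangular (B ^\<^sub>m k) \<and> (\<forall>i<n. (B ^\<^sub>m k) $$ (i, i) = B $$ (i, i) ^ k)"
proof (induction k)
  case 0
  then show ?case using B by auto
next
  case (Suc k)
  let ?P = "B ^\<^sub>m k"
  have P: "?P \<in> carrier_mat n n" using B by simp
  have U': "?P $$ (i, j) = 0" if "j < i" "i < n" for i j
    using Suc that P by (auto simp: upper_triangular_def)
  have UB: "B $$ (i, j) = 0" if "j < i" "i < n" for i j
    using U that B by (auto simp: upper_triangular_def)
  have ent: "(?P * B) $$ (i, j) = (\<Sum>l<n. ?P $$ (i, l) * B $$ (l, j))" if "i < n" "j < n" for i j
    using B P that by (simp add: scalar_prod_def atLeast0LessThan)
  have z: "?P $$ (i, l) * B $$ (l, j) = 0" if "i < n" "l < n" "j < i \<or> (j = i \<and> l \<noteq> i)" for i j l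
    using U'[of l i] UB[of j l] that by (cases "l < i") auto
  have "upper_triangular (?P * B)"
    unfolding upper_triangular_def
    using P B ent z by (auto intro!: sum.neutral simp del: index_mult_mat(1))
  moreover have "(?P * B) $$ (i, i) = B $$ (i, i) ^ Suc k" if "i < n" for i
  proof -
    have "(?P * B) $$ (i, i) = (\<Sum>l\<in>{i}. ?P $$ (i, l) * B $$ (l, i))"
      unfolding ent[OF that that] using that z[of i _ i] by (intro sum.mono_neutral_right) auto
    then show ?thesis using Suc that by simp
  qed
  ultimately show ?case by simp
qed

text \<open>The characteristic polynomial splits over the reals, so a Schur decomposition makes A
  similar to a triangular matrix with the eigenvalues on its diagonal. Powers act on that diagonal
  entrywise, and the trace is invariant under similarity.\<close>

lemma mat_trace_pow_symmetric:
  fixes A :: "real mat"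
  assumes A: "A \<in> carrier_mat n n" and sym: "transpose_mat A = A"
  shows "mat_trace (A ^\<^sub>m k) = (\<Sum>e\<leftarrow>eigenvalues A. e ^ k)"
proof -
  obtain B P Q where s: "schur_decomposition A (eigenvalues A) = (B, P, Q)"
    by (cases "schur_decomposition A (eigenvalues A)")
  from schur_decomposition[OF A char_poly_symmetric(1)[OF A sym] s]
  have w: "similar_mat_wit A B P Q" and U: "upper_triangular B" and d: "diag_mat B = eigenvalues A"
    by auto
  from similar_mat_witD2[OF A w] have c: "B \<in> carrier_mat n n" "P \<in> carrier_mat n n"
    "Q \<in> carrier_mat n n" "Q * P = 1\<^sub>m n" by auto
  have "similar_mat_wit (A ^\<^sub>m k) (B ^\<^sub>m k) P Q" using w by (rule similar_mat_wit_pow)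
  from similar_mat_witD2[OF _ this, of n n] A have "A ^\<^sub>m k = P * (B ^\<^sub>m k) * Q" by auto
  also have "mat_trace \<dots> = mat_trace (Q * (P * (B ^\<^sub>m k)))"
    using c by (intro mat_trace_mult_commute[of _ n n]) auto
  also have "Q * (P * (B ^\<^sub>m k)) = B ^\<^sub>m k"
    using c by (simp flip: assoc_mult_mat[of Q n n P n "B ^\<^sub>m k" n])
  also have "mat_trace (B ^\<^sub>m k) = (\<Sum>i<n. B $$ (i, i) ^ k)"
    using upper_triangular_pow[OF c(1) U, of k] c by (simp add: mat_trace_def)
  also have "\<dots> = (\<Sum>e\<leftarrow>diag_mat B. e ^ k)"
    using c by (simp add: diag_mat_def sum_list_sum_nth atLeast0LessThan)
  finally show ?thesis by (simp add: d)
qed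

text \<open>The Stieltjes measure is identified, through its cdf, with the image of the uniform law
  on the indices under the list of eigenvalues.\<close>

lemma esd_integral:
  fixes A :: "real mat" and f :: "real \<Rightarrow> real"
  assumes A: "A \<in> carrier_mat n n" and sym: "transpose_mat A = A" and n: "n > 0"
    and f: "f \<in> borel_measurable borel"
  shows "integrable (interval_measure (esd A)) f"
    and "(LINT x|interval_measure (esd A). f x) = (\<Sum>e\<leftarrow>eigenvalues A. f e) / real n"
proof -
  let ?es = "eigenvalues A"
  define N where "N = distr (measure_pmf (pmf_of_set {..<n})) borel (\<lambda>i. ?es ! i)"
  have len: "length ?es = n" using length_eigenvalues_symmetric[OF A sym] .
  have ne: "{..<n} \<noteq> {}" using n by auto
  have "real_distribution N"
    unfolding N_def by (intro prob_space.real_distribution_distr prob_space_measure_pmf) simp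
  moreover have "cdf N = esd A"
  proof
    fix x
    have "cdf N x = measure_pmf.prob (pmf_of_set {..<n}) {i. ?es ! i \<le> x}"
      unfolding cdf_def N_def by (subst measure_distr) (auto simp: vimage_def)
    also have "\<dots> = real (card ({..<n} \<inter> {i. ?es ! i \<le> x})) / real n"
      using ne by (subst measure_pmf_of_set) auto
    also have "card ({..<n} \<inter> {i. ?es ! i \<le> x}) = card {i \<in> {1..n}. ?es ! (i - 1) \<le> x}"
      by (rule bij_betw_same_card[of Suc])
         (rule bij_betw_byWitness[where f' = "\<lambda>i. i - 1"], auto)
    finally show "cdf N x = esd A x" using A by (simp add: esd_def)
  qed
  moreover have "distribution_function (esd A)" using A n by (intro distribution_function_esd) auto
  ultimately have N: "interval_measure (esd A) = N"
    by (intro cdf_unique) (auto simp: distribution_function_real_distribution)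
  show "integrable (interval_measure (esd A)) f"
    unfolding N N_def using f ne
    by (subst integrable_distr_eq)
       (auto intro!: integrable_measure_pmf_finite simp: set_pmf_of_set[OF ne] simp del: set_pmf_of_set)
  have "(LINT x|interval_measure (esd A). f x) = (\<Sum>i<n. f (?es ! i)) / real n"
    unfolding N N_def using f ne by (subst integral_distr) (auto simp: integral_pmf_of_set)
  then show "(LINT x|interval_measure (esd A). f x) = (\<Sum>e\<leftarrow>?es. f e) / real n"
    using len by (simp add: sum_list_sum_nth atLeast0LessThan)
qed

section \<open>Lagrange inversion and the explicit moments\<close>

unbundle fps_syntax

text \<open>With \<psi> = X / \<phi> the left side is the residue of j \<psi>^(j-1-s) \<psi>', the
  residue of a derivative unless j = s. The proof carries this out without negative powers.\<close>

lemma lagrange_monomial: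
  fixes \<phi> :: "real fps"
  assumes \<phi>: "\<phi> $ 0 \<noteq> 0" and s: "s \<ge> 1"
  shows "(fps_deriv ((fps_X * inverse \<phi>) ^ j) * \<phi> ^ s) $ (s - 1) = (if j = s then real s else 0)"
proof (cases j)
  case 0
  with s show ?thesis by simp
next
  case (Suc i)
  let ?\<iota> = "inverse \<phi>"
  have inv: "\<phi> * ?\<iota> = 1" using inverse_mult_eq_1[OF \<phi>] by (simp add: mult.commute)
  have invp: "?\<iota> ^ k * \<phi> ^ k = 1" for k
    using inv by (simp add: mult.commute flip: power_mult_distrib)
  have "fps_deriv ?\<iota> = - fps_deriv \<phi> * ?\<iota>\<^sup>2" using fps_inverse_deriv[OF \<phi>] by simp
  then have D: "fps_deriv ((fps_X * ?\<iota>) ^ j) =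
      fps_X ^ i * (of_nat j * (?\<iota> ^ i * (?\<iota> - fps_X * fps_deriv \<phi> * ?\<iota>\<^sup>2)))"
  proof -
    have "fps_deriv ((fps_X * ?\<iota>) ^ j) = of_nat j * fps_deriv (fps_X * ?\<iota>) * (fps_X * ?\<iota>) ^ i"
      using fps_deriv_power'[of "fps_X * ?\<iota>" j] Suc by simp
    also have "fps_deriv (fps_X * ?\<iota>) = ?\<iota> - fps_X * fps_deriv \<phi> * ?\<iota>\<^sup>2"
      using \<open>fps_deriv ?\<iota> = _\<close> by simp
    finally show ?thesis by (simp only: power_mult_distrib mult_ac)
  qed
  show ?thesis
  proof (cases "j \<le> s")
    case False
    then show ?thesis using s Suc unfolding D mult.assoc fps_X_power_mult_nth by simp
  next
    case True
    define m where "m = s - j"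
    have sm: "s = Suc (i + m)" using True Suc by (simp add: m_def)
    have "?\<iota> ^ i * (?\<iota> - fps_X * fps_deriv \<phi> * ?\<iota>\<^sup>2) * \<phi> ^ s =
        (?\<iota> ^ i * \<phi> ^ i) * (?\<iota> * \<phi>) * (\<phi> ^ m - fps_X * fps_deriv \<phi> * \<phi> ^ m * ?\<iota>)"
      by (simp add: sm power_add power2_eq_square algebra_simps)
    also have "\<dots> = \<phi> ^ m - fps_X * fps_deriv \<phi> * \<phi> ^ m * ?\<iota>"
      using inv by (simp add: invp mult.commute[of ?\<iota>])
    finally have "fps_deriv ((fps_X * ?\<iota>) ^ j) * \<phi> ^ s =
        fps_X ^ i * (of_nat j * (\<phi> ^ m - fps_X * fps_deriv \<phi> * \<phi> ^ m * ?\<iota>))"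
      unfolding D by (simp only: mult.assoc)
    then have eq: "(fps_deriv ((fps_X * ?\<iota>) ^ j) * \<phi> ^ s) $ (s - 1) =
        real j * (\<phi> ^ m - fps_X * fps_deriv \<phi> * \<phi> ^ m * ?\<iota>) $ m"
      by (simp add: fps_X_power_mult_nth sm fps_mult_of_nat_nth)
    show ?thesis
    proof (cases m)
      case 0
      with eq sm Suc show ?thesis by (simp add: mult.assoc)
    next
      case m: (Suc l)
      have "fps_X * fps_deriv \<phi> * \<phi> ^ m * ?\<iota> = fps_X * (fps_deriv \<phi> * \<phi> ^ l) * (\<phi> * ?\<iota>)"
        by (simp add: m algebra_simps)
      then have e: "fps_X * fps_deriv \<phi> * \<phi> ^ m * ?\<iota> = fps_X * (fps_deriv \<phi> * \<phi> ^ l)"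
        using inv by simp
      \<comment> \<open>The two terms cancel: m X \<phi>' \<phi>^(m-1) is X times the derivative of
        \<phi>^m, and its coefficient at m is m times that of \<phi>^m.\<close>
      have "real m * (fps_deriv \<phi> * \<phi> ^ l) $ l = fps_deriv (\<phi> ^ m) $ l"
        unfolding m fps_deriv_power' diff_Suc_1 mult.assoc fps_mult_of_nat_nth ..
      also have "\<dots> = real m * (\<phi> ^ m) $ m" by (simp only: m fps_deriv_nth Suc_eq_plus1)
      finally have "(fps_deriv \<phi> * \<phi> ^ l) $ l = (\<phi> ^ m) $ m" by (simp add: m)
      then have "(\<phi> ^ m - fps_X * fps_deriv \<phi> * \<phi> ^ m * ?\<iota>) $ m = 0"
        unfolding e by (simp add: m)
      with eq sm Suc m show ?thesis by simp
    qed
  qed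
qed

text \<open>With \<open>\<psi> = X / \<phi>\<close>, the compositional inverse of \<open>w\<close>, one has \<open>H = \<Sum> c\<^sub>j \<psi>\<^sup>j\<close> for
  \<open>c = H(w)\<close>; the previous lemma picks out \<open>c\<^sub>s\<close>.\<close>

lemma lagrange_inversion:
  fixes \<phi> w H :: "real fps"
  assumes \<phi>: "\<phi> $ 0 \<noteq> 0" and w: "w = fps_X * (\<phi> oo w)" and s: "s \<ge> 1"
  shows "real s * (H oo w) $ s = (fps_deriv H * \<phi> ^ s) $ (s - 1)"
proof -
  define \<psi> where "\<psi> = fps_X * inverse \<phi>"
  define c where "c = H oo w"
  have w0: "w $ 0 = 0" by (subst w) simp
  have \<psi>0: "\<psi> $ 0 = 0" and \<psi>1: "\<psi> $ 1 \<noteq> 0" using \<phi> by (auto simp: \<psi>_def)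
  have "\<psi> oo w = w * inverse (\<phi> oo w)"
    using w0 \<phi> by (simp add: \<psi>_def fps_compose_mult_distrib fps_inverse_compose)
  also have "\<dots> = fps_X * ((\<phi> oo w) * inverse (\<phi> oo w))"
    by (subst w) (simp add: mult.assoc)
  also have "(\<phi> oo w) * inverse (\<phi> oo w) = 1"
    using \<phi> by (subst mult.commute, intro inverse_mult_eq_1) simp
  finally have \<psi>w: "\<psi> oo w = fps_X" by simp
  \<comment> \<open>So far w is inverse to \<psi> on one side only. As \<psi> has a compositional
    inverse, w must be that inverse, which gives the other side.\<close>
  have "w = (fps_inv \<psi> oo \<psi>) oo w" using \<psi>0 \<psi>1 w0 by (simp add: fps_inv)
  also have "\<dots> = fps_inv \<psi>"
    using \<psi>0 w0 by (simp add: fps_compose_assoc[symmetric] \<psi>w)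
  finally have "w oo \<psi> = fps_X" using \<psi>0 \<psi>1 fps_inv by simp
  then have H: "H = c oo \<psi>"
    unfolding c_def using \<psi>0 w0 by (simp add: fps_compose_assoc[symmetric])
  \<comment> \<open>Powers of \<psi> beyond n do not reach the coefficient n, so one summation bound
    s serves every n \<le> s.\<close>
  have Hn: "H $ n = (\<Sum>j=0..s. c $ j * (\<psi> ^ j) $ n)" if "n \<le> s" for n
    unfolding H fps_compose_nth
    using that \<psi>0 by (intro sum.mono_neutral_left) (auto intro: startsby_zero_power_prefix[rule_format])
  have "(fps_deriv H * \<phi> ^ s) $ (s - 1) =
      (\<Sum>i=0..s-1. real (i + 1) * H $ (i + 1) * (\<phi> ^ s) $ (s - 1 - i))"
    by (simp add: fps_mult_nth)
  also have "\<dots> = (\<Sum>i=0..s-1. \<Sum>j=0..s. c $ j * (fps_deriv (\<psi> ^ j) $ i * (\<phi> ^ s) $ (s - 1 - i)))"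
    using s by (intro sum.cong refl) (simp add: Hn sum_distrib_left sum_distrib_right mult_ac)
  also have "\<dots> = (\<Sum>j=0..s. c $ j * (fps_deriv (\<psi> ^ j) * \<phi> ^ s) $ (s - 1))"
    by (subst sum.swap) (simp add: fps_mult_nth sum_distrib_left)
  also have "\<dots> = (\<Sum>j=0..s. if j = s then c $ j * real s else 0)"
    unfolding \<psi>_def lagrange_monomial[OF \<phi> s] by (intro sum.cong) auto
  also have "\<dots> = real s * c $ s" by simp
  finally show ?thesis by (simp add: c_def)
qed

context
  fixes L :: "nat \<Rightarrow> real" and t :: "nat \<Rightarrow> nat \<Rightarrow> real"
  assumes t_0: "\<And>h. t 0 h = L h"
    and t_Suc: "\<And>s h. t (Suc s) h = (\<Sum>i\<le>s. t i 1 * t (s - i) (Suc h))"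
begin

text \<open>The generating functions satisfy T_h = L_h + w T_(h+1) with w = X T_1. Iterating
  suggests that T_h is the sum of L_(h+j) w^j, that is, G_h composed with w. For h = 1 this says w =
  X \<phi>(w), the setting of Lagrange inversion; for h = 0 the series to expand is H = L_0 + X
  \<phi>.\<close>

lemma tree_recursion_closed_form:
  assumes s: "s \<ge> 1"
  shows "t s 0 = 2 / (real s + 1) * (Abs_fps (\<lambda>j. L (Suc j)) ^ (s + 1)) $ (s - 1)"
proof -
  define T where "T h = Abs_fps (\<lambda>s. t s h)" for h
  define G where "G h = Abs_fps (\<lambda>j. L (h + j))" for h
  define w where "w = fps_X * T 1"
  define \<phi> where "\<phi> = G 1"
  have w0: "w $ 0 = 0" by (simp add: w_def)
  have T_rec: "T h = fps_const (L h) + w * T (Suc h)" for h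
  proof (rule fps_ext)
    fix n
    show "T h $ n = (fps_const (L h) + w * T (Suc h)) $ n"
    proof (cases n)
      case 0
      then show ?thesis by (simp add: T_def t_0 w_def)
    next
      case (Suc m)
      have "(w * T (Suc h)) $ n = (T 1 * T (Suc h)) $ m" by (simp add: w_def Suc mult.assoc)
      also have "\<dots> = t (Suc m) h" by (simp only: fps_mult_nth T_def t_Suc fps_nth_Abs_fps atLeast0AtMost)
      finally show ?thesis by (simp add: T_def Suc)
    qed
  qed
  have G_rec: "G h = fps_const (L h) + fps_X * G (Suc h)" for h
    by (intro fps_ext) (auto simp: G_def)
  have Gw_rec: "G h oo w = fps_const (L h) + w * (G (Suc h) oo w)" for h
    by (subst G_rec) (simp add: fps_compose_add_distrib fps_compose_mult_distrib w0)
  \<comment> \<open>The differences satisfy D_h = w D_(h+1). As w has no constant term, the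
    coefficient n of D_h involves only smaller coefficients of D_(h+1).\<close>
  have "(T h - (G h oo w)) $ n = 0" for h n
  proof (induction n arbitrary: h rule: less_induct)
    case (less n)
    have "T h - (G h oo w) = fps_X * (T 1 * (T (Suc h) - (G (Suc h) oo w)))"
      by (subst T_rec, subst Gw_rec) (simp add: w_def algebra_simps)
    also have "\<dots> $ n = 0"
    proof (cases n)
      case (Suc m)
      have "(fps_X * (T 1 * (T (Suc h) - (G (Suc h) oo w)))) $ n =
          (T 1 * (T (Suc h) - (G (Suc h) oo w))) $ m" by (simp add: Suc)
      also have "\<dots> = 0"
        unfolding fps_mult_nth using less[of _ "Suc h"] Suc
        by (intro sum.neutral ballI) (simp del: fps_sub_nth)
      finally show ?thesis .
    qed simp
    finally show ?case .
  qed
  then have T: "T h = G h oo w" for h by (simp add: fps_eq_iff)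
  have w: "w = fps_X * (\<phi> oo w)" by (subst w_def) (simp add: T \<phi>_def)
  have G0: "G 0 = fps_const (L 0) + fps_X * \<phi>" using G_rec[of 0] by (simp add: \<phi>_def)
  have ts: "t s 0 = (G 0 oo w) $ s" using T[of 0] by (simp add: T_def fps_eq_iff)
  have "(G 0 oo w) $ s = 2 / (real s + 1) * (\<phi> ^ (s + 1)) $ (s - 1)"
  proof (cases "\<phi> $ 0 = 0")
    \<comment> \<open>Lagrange inversion needs \<phi> invertible. If L_1 = 0, the equation w = X w
      g(w) forces w = 0 and both sides vanish.\<close>
    case True
    define g where "g = fps_shift 1 \<phi>"
    have g: "\<phi> = fps_X * g"
      by (intro fps_ext) (use True in \<open>auto simp: g_def gr0_conv_Suc\<close>)
    have "w * (1 - fps_X * (g oo w)) = 0"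
    proof -
      have "\<phi> oo w = w * (g oo w)" unfolding g by (simp add: fps_compose_mult_distrib w0)
      then show ?thesis using w by (simp add: algebra_simps)
    qed
    moreover have "(1 - fps_X * (g oo w)) $ 0 \<noteq> 0" by simp
    then have "1 - fps_X * (g oo w) \<noteq> 0" by (metis fps_zero_nth)
    ultimately have "w = 0" by simp
    moreover have "(\<phi> ^ (s + 1)) $ (s - 1) = 0"
      unfolding g power_mult_distrib fps_X_power_mult_nth by simp
    ultimately show ?thesis using s by (simp add: fps_compose_0_right)
  next
    case False
    obtain r where r: "s = Suc r" using s by (cases s) auto
    have "real s * (G 0 oo w) $ s = ((\<phi> + fps_X * fps_deriv \<phi>) * \<phi> ^ s) $ r"
      using lagrange_inversion[OF False w s, of "G 0"] unfolding G0 by (simp add: r add.commute)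
    also have "(\<phi> + fps_X * fps_deriv \<phi>) * \<phi> ^ s = \<phi> ^ (s + 1) + fps_X * (fps_deriv \<phi> * \<phi> ^ s)"
      by (simp add: algebra_simps)
    finally have 1: "real s * (G 0 oo w) $ s =
        (\<phi> ^ (s + 1)) $ r + (fps_X * (fps_deriv \<phi> * \<phi> ^ s)) $ r" by simp
    have P: "fps_deriv (\<phi> ^ (s + 1)) = of_nat (s + 1) * (fps_deriv \<phi> * \<phi> ^ s)"
      unfolding fps_deriv_power' by (simp only: add_diff_cancel_right' mult.assoc)
    have XD: "(fps_X * fps_deriv Z) $ r = real r * Z $ r" for Z :: "real fps"
      by (cases r) simp_all
    have "real (s + 1) * (fps_X * (fps_deriv \<phi> * \<phi> ^ s)) $ r = (fps_X * fps_deriv (\<phi> ^ (s + 1))) $ r"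
      unfolding P fps_X_mult_nth fps_mult_of_nat_nth by simp
    also have "\<dots> = real r * (\<phi> ^ (s + 1)) $ r" by (rule XD)
    finally have 2: "(fps_X * (fps_deriv \<phi> * \<phi> ^ s)) $ r = real r * (\<phi> ^ (s + 1)) $ r / (real s + 1)"
      by (simp add: field_simps)
    \<comment> \<open>With r = s - 1 the two terms combine to 1 + (s - 1) / (s + 1) = 2 s / (s + 1),
      the origin of the factor 2 / (s + 1).\<close>
    have "real s * (G 0 oo w) $ s = real s * (2 / (real s + 1) * (\<phi> ^ (s + 1)) $ r)"
      unfolding 1 2 by (simp add: r field_simps)
    moreover have "real s \<noteq> 0" "s - 1 = r" using r by auto
    ultimately show ?thesis by (metis mult_cancel_left)
  qed
  then show ?thesis unfolding ts by (simp add: \<phi>_def G_def)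
qed

end

lemma fps_power_nth_list:
  fixes a :: "real fps"
  shows "(a ^ Suc m) $ n = (\<Sum>v\<in>natpermute n (Suc m). \<Prod>x\<leftarrow>v. a $ x)"
proof -
  have "(a ^ Suc m) $ n = (\<Sum>v\<in>natpermute n (m + 1). \<Prod>j\<in>{0..m}. a $ (v ! j))"
    using fps_power_nth_Suc[of a m n] by simp
  also have "\<dots> = (\<Sum>v\<in>natpermute n (Suc m). \<Prod>x\<leftarrow>v. a $ x)"
  proof (intro sum.cong)
    fix v assume "v \<in> natpermute n (Suc m)"
    then have "length v = Suc m" by (simp add: natpermute_def)
    then show "(\<Prod>j\<in>{0..m}. a $ (v ! j)) = (\<Prod>x\<leftarrow>v. a $ x)"
      by (simp add: prod.list_conv_set_nth atLeast0LessThan lessThan_Suc_atMost atLeast0AtMost)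
  qed simp
  finally show ?thesis .
qed

text \<open>The coefficient is a sum over lists of s + 1 naturals with sum s - 1, an entry x
  contributing \<open>\<Lambda> (Suc x)\<close>. Lists are grouped by r_j, the number of entries
  equal to j - 1. Then r_j sums to s + 1 and (j - 1) r_j to s - 1, so j r_j sums to 2 s; the
  multinomial coefficient counts the rearrangements.\<close>

lemma even_moment_eq_coeff:
  assumes s: "s \<ge> 1"
  shows "even_moment \<Lambda> s = 2 / (real s + 1) * (Abs_fps (\<lambda>j. \<Lambda> (Suc j)) ^ (s + 1)) $ (s - 1)"
proof -
  let ?N = "natpermute (s - 1) (Suc s)"
  define f where "f v = (\<Prod>x\<leftarrow>v. \<Lambda> (Suc x))" for v
  define rv where "rv v = (\<lambda>j\<in>{1..s}. count_list v (j - 1))" for v :: "nat list"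
  define A where "A r = (\<Sum>j=1..s. replicate_mset (r j) (j - 1))" for r :: "nat \<Rightarrow> nat"
  have cA: "count (A r) x = (if x < s then r (Suc x) else 0)" for r x
  proof -
    have "count (A r) x = (\<Sum>j=1..s. if j = Suc x then r j else 0)"
      unfolding A_def count_sum by (intro sum.cong) auto
    then show ?thesis by auto
  qed
  have sizeA: "size (A r) = (\<Sum>j=1..s. r j)" for r
    unfolding A_def by (induction s) simp_all
  have sumA: "sum_mset (A r) = (\<Sum>j=1..s. r j * (j - 1))" for r
    unfolding A_def by (induction s) (simp_all add: sum_mset_replicate_mset)
  have prodA: "prod_mset (image_mset (\<lambda>x. \<Lambda> (Suc x)) (A r)) = (\<Prod>j=1..s. \<Lambda> j ^ r j)" for r
    unfolding A_def by (induction s) simp_all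
  have rvR: "rv v \<in> R_set s" and mv: "mset v = A (rv v)" if v: "v \<in> ?N" for v
  proof -
    have v': "length v = Suc s" "sum_list v = s - 1" using v by (auto simp: natpermute_def)
    \<comment> \<open>No entry exceeds the total s - 1, so the indices 1 to s account for all
      entries.\<close>
    have lt: "x < s" if "x \<in> set v" for x
      using member_le_sum_list[OF that] v' s by simp
    show m: "mset v = A (rv v)"
      by (rule multiset_eqI) (auto simp: cA rv_def count_mset dest: lt intro: count_notin)
    have 1: "(\<Sum>j=1..s. rv v j) = s + 1" using sizeA[of "rv v"] v' by (simp flip: m)
    have 2: "(\<Sum>j=1..s. rv v j * (j - 1)) = s - 1"
      using sumA[of "rv v"] v' by (simp add: sum_mset_sum_list flip: m)
    have "(\<Sum>j=1..s. j * rv v j) = (\<Sum>j=1..s. rv v j * (j - 1) + rv v j)"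
      by (intro sum.cong) (auto simp: algebra_simps)
    also have "\<dots> = 2 * s" using 1 2 s by (simp add: sum.distrib)
    finally show "rv v \<in> R_set s" using 1 by (auto simp: R_set_def rv_def)
  qed
  have fib: "{v \<in> ?N. rv v = r} = permutations_of_multiset (A r)" if r: "r \<in> R_set s" for r
  proof (intro equalityI subsetI)
    fix v assume "v \<in> {v \<in> ?N. rv v = r}"
    then show "v \<in> permutations_of_multiset (A r)" using mv by (auto simp: permutations_of_multiset_def)
  next
    fix v assume "v \<in> permutations_of_multiset (A r)"
    then have m: "mset v = A r" by (simp add: permutations_of_multiset_def)
    have R: "(\<Sum>j=1..s. r j) = s + 1" "(\<Sum>j=1..s. j * r j) = 2 * s" "r \<in> extensional {1..s}"
      using r by (auto simp: R_set_def PiE_def)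
    have "length v = s + 1" using sizeA[of r] R by (metis m size_mset)
    moreover have "sum_list v = s - 1"
    proof -
      have "(\<Sum>j=1..s. r j * (j - 1)) + (\<Sum>j=1..s. r j) = (\<Sum>j=1..s. j * r j)"
        unfolding sum.distrib[symmetric] by (intro sum.cong) (auto simp: algebra_simps)
      then show ?thesis using sumA[of r] R by (simp add: sum_mset_sum_list flip: m)
    qed
    moreover have "rv v = r"
    proof
      fix j show "rv v j = r j"
      proof (cases "j \<in> {1..s}")
        case True
        then have "count_list v (j - 1) = r j"
          using cA[of r "j - 1"] unfolding m[symmetric] by (auto simp: count_mset)
        with True show ?thesis by (simp add: rv_def)
      next
        case False
        then show ?thesis using extensional_arb[OF R(3) False] by (auto simp: rv_def)
      qed
    qed
    ultimately show "v \<in> {v \<in> ?N. rv v = r}" by (simp add: natpermute_def)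
  qed
  have fibsum: "(\<Sum>v | v \<in> ?N \<and> rv v = r. f v) = multinomial s r * (\<Prod>j=1..s. \<Lambda> j ^ r j)"
    if r: "r \<in> R_set s" for r
  proof -
    have "f v = (\<Prod>j=1..s. \<Lambda> j ^ r j)" if "v \<in> permutations_of_multiset (A r)" for v
    proof -
      have "mset v = A r" using that by (simp add: permutations_of_multiset_def)
      then have "f v = prod_mset (image_mset (\<lambda>x. \<Lambda> (Suc x)) (A r))"
        unfolding f_def by (metis mset_map prod_mset_prod_list)
      then show ?thesis by (simp only: prodA)
    qed
    then have "(\<Sum>v | v \<in> ?N \<and> rv v = r. f v) =
        real (card (permutations_of_multiset (A r))) * (\<Prod>j=1..s. \<Lambda> j ^ r j)"
      using fib[OF r] by simp
    moreover have "real (card (permutations_of_multiset (A r))) = multinomial s r"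
    proof -
      have "(\<Prod>x\<in>set_mset (A r). fact (count (A r) x)) = (\<Prod>x\<in>{..<s}. fact (count (A r) x) :: nat)"
        by (intro prod.mono_neutral_left)
           (auto simp: cA not_in_iff count_greater_zero_iff[symmetric] simp del: count_greater_zero_iff split: if_splits)
      also have "\<dots> = (\<Prod>x\<in>{..<s}. fact (r (Suc x)))" by (intro prod.cong) (auto simp: cA)
      also have "\<dots> = (\<Prod>j=1..s. fact (r j))"
        by (rule prod.reindex_bij_witness[of _ "\<lambda>j. j - 1" Suc]) auto
      finally have "card (permutations_of_multiset (A r)) * (\<Prod>j=1..s. fact (r j)) = fact (s + 1)"
        using card_permutations_of_multiset_aux[of "A r"] r by (simp add: sizeA R_set_def)
      then have "real (card (permutations_of_multiset (A r)) * (\<Prod>j=1..s. fact (r j))) = real (fact (s + 1))"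
        by (rule arg_cong)
      then show ?thesis by (simp add: multinomial_def field_simps del: fact_Suc)
    qed
    ultimately show ?thesis by simp
  qed
  have "(Abs_fps (\<lambda>j. \<Lambda> (Suc j)) ^ (s + 1)) $ (s - 1) = (\<Sum>v\<in>?N. f v)"
    by (simp only: Suc_eq_plus1[symmetric] fps_power_nth_list fps_nth_Abs_fps f_def)
  also have "\<dots> = (\<Sum>r\<in>R_set s. \<Sum>v | v \<in> ?N \<and> rv v = r. f v)"
    using rvR by (intro sum.group[symmetric] natpermute_finite finite_R_set) auto
  also have "\<dots> = (\<Sum>r\<in>R_set s. multinomial s r * (\<Prod>j=1..s. \<Lambda> j ^ r j))"
    by (intro sum.cong refl fibsum)
  finally show ?thesis
    unfolding even_moment_def by (simp add: sum_distrib_left mult.assoc)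
qed

text \<open>Every product in the coefficient has total degree (s - 1) + (s + 1) = 2 s, and the
  number of lists, 2 s - 1 choose s - 1, is below 2^(2 s).\<close>

lemma even_moment_bound:
  assumes \<Lambda>: "\<And>k. k \<ge> 1 \<Longrightarrow> \<bar>\<Lambda> k\<bar> \<le> K ^ k" and s: "s \<ge> 1" and K: "K \<ge> 0"
  shows "\<bar>even_moment \<Lambda> s\<bar> \<le> (2 * K) ^ (2 * s)"
proof -
  let ?N = "natpermute (s - 1) (Suc s)"
  have pv: "\<bar>\<Prod>x\<leftarrow>v. \<Lambda> (Suc x)\<bar> \<le> K ^ (sum_list v + length v)" for v
  proof (induction v)
    case (Cons x v)
    then have "\<bar>\<Lambda> (Suc x)\<bar> * \<bar>\<Prod>x\<leftarrow>v. \<Lambda> (Suc x)\<bar> \<le> K ^ Suc x * K ^ (sum_list v + length v)"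
      using \<Lambda>[of "Suc x"] K by (intro mult_mono) auto
    then show ?case by (simp add: abs_mult power_add mult_ac)
  qed simp
  have "\<bar>(Abs_fps (\<lambda>j. \<Lambda> (Suc j)) ^ (s + 1)) $ (s - 1)\<bar> \<le> (\<Sum>v\<in>?N. \<bar>\<Prod>x\<leftarrow>v. \<Lambda> (Suc x)\<bar>)"
    unfolding Suc_eq_plus1[symmetric] fps_power_nth_list fps_nth_Abs_fps by (rule sum_abs)
  also have "\<dots> \<le> (\<Sum>v\<in>?N. K ^ (2 * s))"
  proof (rule sum_mono)
    fix v assume "v \<in> ?N"
    then have "sum_list v + length v = 2 * s" using s by (auto simp: natpermute_def)
    then show "\<bar>\<Prod>x\<leftarrow>v. \<Lambda> (Suc x)\<bar> \<le> K ^ (2 * s)" using pv[of v] by simp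
  qed
  also have "\<dots> = real (card ?N) * K ^ (2 * s)" by simp
  also have "\<dots> \<le> 2 ^ (2 * s) * K ^ (2 * s)"
  proof (rule mult_right_mono)
    have "card ?N = (2 * s - 1) choose (s - 1)"
      using card_length_sum_list[of "Suc s" "s - 1"] s by (simp add: natpermute_def mult_2)
    also have "\<dots> \<le> 2 ^ (2 * s - 1)" by (rule binomial_le_pow2)
    also have "\<dots> \<le> 2 ^ (2 * s)" by (intro power_increasing) auto
    finally show "real (card ?N) \<le> 2 ^ (2 * s)" by (metis of_nat_le_iff of_nat_numeral of_nat_power)
  qed (use K in auto)
  finally have "\<bar>(Abs_fps (\<lambda>j. \<Lambda> (Suc j)) ^ (s + 1)) $ (s - 1)\<bar> \<le> (2 * K) ^ (2 * s)"
    by (simp add: power_mult_distrib)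
  moreover have "\<bar>2 / (real s + 1)\<bar> \<le> 1" using s by simp
  ultimately have "\<bar>2 / (real s + 1)\<bar> * \<bar>(Abs_fps (\<lambda>j. \<Lambda> (Suc j)) ^ (s + 1)) $ (s - 1)\<bar>
      \<le> 1 * (2 * K) ^ (2 * s)"
    by (intro mult_mono) auto
  then show ?thesis unfolding even_moment_eq_coeff[OF s] abs_mult by simp
qed

unbundle no fps_syntax

section \<open>Walks around trees\<close>

definition closed_walks :: "nat \<Rightarrow> nat \<Rightarrow> nat list set" where
  "closed_walks n k = {w. set w \<subseteq> {1..n} \<and> length w = Suc k \<and> hd w = last w}"

lemma finite_closed_walks: "finite (closed_walks n k)"
  unfolding closed_walks_def
  by (rule finite_subset[OF _ finite_lists_length_eq[of "{1..n}" "Suc k"]]) auto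

definition walks :: "nat \<Rightarrow> nat \<Rightarrow> nat \<Rightarrow> nat \<Rightarrow> nat list set" where
  "walks n k x y = {w. set w \<subseteq> {1..n} \<and> length w = Suc k \<and> hd w = x \<and> last w = y}"

lemma finite_walks: "finite (walks n k x y)"
  unfolding walks_def
  by (rule finite_subset[OF _ finite_lists_length_eq[of "{1..n}" "Suc k"]]) auto

lemma walks_0: "x \<in> {1..n} \<Longrightarrow> walks n 0 x y = (if x = y then {[x]} else {})"
  by (auto simp: walks_def length_Suc_conv)

lemma walks_Suc:
  assumes "y \<in> {1..n}"
  shows "walks n (Suc k) x y = (\<Union>z\<in>{1..n}. (\<lambda>w. w @ [y]) ` walks n k x z)"
proof (intro equalityI subsetI)
  fix w assume w: "w \<in> walks n (Suc k) x y"
  then have "w \<noteq> []" by (auto simp: walks_def)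
  define u where "u = butlast w"
  have wu: "w = u @ [y]" using w \<open>w \<noteq> []\<close> by (auto simp: walks_def u_def)
  have u: "length u = Suc k" "set u \<subseteq> {1..n}" using w by (auto simp: walks_def wu)
  then have "u \<noteq> []" by auto
  then have "hd u = x" "last u \<in> {1..n}"
    using w u last_in_set[of u] by (auto simp: walks_def wu simp del: last_in_set)
  then show "w \<in> (\<Union>z\<in>{1..n}. (\<lambda>w. w @ [y]) ` walks n k x z)"
    using u by (intro UN_I[of "last u"]) (auto simp: wu walks_def)
qed (use assms in \<open>auto simp: walks_def hd_append\<close>)

text \<open>Multiplying on the right appends one step to each walk. Entries are a function of the
  undirected edge, which builds in the symmetry of the matrix.\<close>

lemma mat_pow_walks:
  fixes c :: "nat \<times> nat \<Rightarrow> real"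
  assumes "i < n" "j < n"
  shows "(Matrix.mat n n (\<lambda>(i, j). c (edge (Suc i) (Suc j))) ^\<^sub>m k) $$ (i, j) =
    (\<Sum>w\<in>walks n k (Suc i) (Suc j). \<Prod>e\<leftarrow>wedges w. c e)"
  using assms
proof (induction k arbitrary: j)
  case 0
  then show ?case by (simp add: walks_0)
next
  case (Suc k)
  let ?A = "Matrix.mat n n (\<lambda>(i, j). c (edge (Suc i) (Suc j)))"
  have A: "?A \<in> carrier_mat n n" by simp
  have P: "?A ^\<^sub>m k \<in> carrier_mat n n" using A by (rule pow_carrier_mat)
  have "(?A ^\<^sub>m Suc k) $$ (i, j) = (\<Sum>l<n. (?A ^\<^sub>m k) $$ (i, l) * c (edge (Suc l) (Suc j)))"
    using P Suc.prems by (simp add: scalar_prod_def atLeast0LessThan)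
  also have "\<dots> = (\<Sum>l<n. \<Sum>w\<in>walks n k (Suc i) (Suc l).
      (\<Prod>e\<leftarrow>wedges w. c e) * c (edge (Suc l) (Suc j)))"
    using Suc by (intro sum.cong) (auto simp: sum_distrib_right)
  also have "\<dots> = (\<Sum>l<n. \<Sum>w\<in>walks n k (Suc i) (Suc l). \<Prod>e\<leftarrow>wedges (w @ [Suc j]). c e)"
  proof (intro sum.cong refl)
    fix l w assume "w \<in> walks n k (Suc i) (Suc l)"
    then have "w \<noteq> []" "last w = Suc l" by (auto simp: walks_def)
    then show "(\<Prod>e\<leftarrow>wedges w. c e) * c (edge (Suc l) (Suc j)) = (\<Prod>e\<leftarrow>wedges (w @ [Suc j]). c e)"
      by (simp add: wedges_append)
  qed
  also have "\<dots> = (\<Sum>z\<in>{1..n}. \<Sum>w\<in>walks n k (Suc i) z. \<Prod>e\<leftarrow>wedges (w @ [Suc j]). c e)"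
    by (rule sum.reindex_bij_witness[of _ "\<lambda>z. z - 1" Suc]) auto
  also have "\<dots> = (\<Sum>z\<in>{1..n}. \<Sum>w\<in>(\<lambda>w. w @ [Suc j]) ` walks n k (Suc i) z. \<Prod>e\<leftarrow>wedges w. c e)"
    by (rule sum.cong[OF refl], subst sum.reindex) (auto simp: inj_on_def)
  also have "\<dots> = (\<Sum>w\<in>walks n (Suc k) (Suc i) (Suc j). \<Prod>e\<leftarrow>wedges w. c e)"
    using Suc.prems finite_walks
    by (subst walks_Suc, simp, subst sum.UNION_disjoint) (auto simp: walks_def)
  finally show ?case .
qed

lemma mat_trace_pow_walks:
  fixes c :: "nat \<times> nat \<Rightarrow> real"
  shows "mat_trace (Matrix.mat n n (\<lambda>(i, j). c (edge (Suc i) (Suc j))) ^\<^sub>m k) =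
    (\<Sum>w\<in>closed_walks n k. \<Prod>e\<leftarrow>wedges w. c e)"
proof -
  have U: "closed_walks n k = (\<Union>x\<in>{1..n}. walks n k x x)"
    by (auto simp: closed_walks_def walks_def) (metis hd_in_set length_0_conv atLeastAtMost_iff nat.simps(3) subsetD)+
  have "mat_trace (Matrix.mat n n (\<lambda>(i, j). c (edge (Suc i) (Suc j))) ^\<^sub>m k) =
      (\<Sum>i<n. \<Sum>w\<in>walks n k (Suc i) (Suc i). \<Prod>e\<leftarrow>wedges w. c e)"
    unfolding mat_trace_def by (intro sum.cong) (auto simp: mat_pow_walks)
  also have "\<dots> = (\<Sum>x\<in>{1..n}. \<Sum>w\<in>walks n k x x. \<Prod>e\<leftarrow>wedges w. c e)"
    by (rule sum.reindex_bij_witness[of _ "\<lambda>z. z - 1" Suc]) auto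
  also have "\<dots> = (\<Sum>w\<in>closed_walks n k. \<Prod>e\<leftarrow>wedges w. c e)"
    unfolding U using finite_walks by (subst sum.UNION_disjoint) (auto simp: walks_def)
  finally show ?thesis .
qed

text \<open>The product runs over distinct edges: a good walk uses each exactly twice and so
  contributes one variance per edge.\<close>

definition weight :: "(nat \<Rightarrow> real) \<Rightarrow> nat list \<Rightarrow> real" where
  "weight \<sigma> w = (\<Prod>(i, j)\<in>set (wedges w). \<sigma> i * \<sigma> j)"

definition good_walks :: "nat \<Rightarrow> nat \<Rightarrow> nat list set" where
  "good_walks n s = {w \<in> closed_walks n (2 * s). good w}"

text \<open>With the power of \<open>\<sigma>\<close> at the starting vertex the recursion closes: attaching a branch at
  that vertex contributes one more factor.\<close>

definition good_sum :: "(nat \<Rightarrow> real) \<Rightarrow> nat \<Rightarrow> nat \<Rightarrow> nat \<Rightarrow> real" where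
  "good_sum \<sigma> n s h = (\<Sum>w\<in>good_walks n s. \<sigma> (hd w) ^ h * weight \<sigma> w)"

context
  notes sum.cong [fundef_cong]
begin

text \<open>The limit of \<open>good_sum\<close> divided by n^(s+1). The average of the zeroth
  powers is 1, whatever the value of \<open>\<Lambda> 0\<close>.\<close>

fun tree_moment :: "(nat \<Rightarrow> real) \<Rightarrow> nat \<Rightarrow> nat \<Rightarrow> real" where
  "tree_moment \<Lambda> 0 h = (if h = 0 then 1 else \<Lambda> h)"
| "tree_moment \<Lambda> (Suc s) h = (\<Sum>i\<le>s. tree_moment \<Lambda> i 1 * tree_moment \<Lambda> (s - i) (Suc h))"

end

lemma finite_good_walks: "finite (good_walks n s)"
  unfolding good_walks_def by (rule finite_subset[OF _ finite_closed_walks]) auto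

lemma good_walksD:
  assumes "w \<in> good_walks n s"
  shows "set w \<subseteq> {1..n}" "length w = 2 * s + 1" "good w" "card (set w) = s + 1" "w \<noteq> []"
    "hd w \<in> {1..n}"
proof -
  show 1: "set w \<subseteq> {1..n}" "length w = 2 * s + 1" "good w"
    using assms by (auto simp: good_walks_def closed_walks_def)
  then show "card (set w) = s + 1" "w \<noteq> []" by (auto simp: good_def)
  then show "hd w \<in> {1..n}" using 1 hd_in_set by blast
qed

lemma good_walksI: "set w \<subseteq> {1..n} \<Longrightarrow> length w = 2 * s + 1 \<Longrightarrow> good w \<Longrightarrow> w \<in> good_walks n s"
  by (auto simp: good_walks_def closed_walks_def good_def)

lemma good_walks_0: "good_walks n 0 = (\<lambda>i. [i]) ` {1..n}"
  by (auto simp: good_walks_def closed_walks_def good_def heavy_def length_Suc_conv)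

lemma weight_join:
  assumes "good p" "good q" "set p \<inter> set q = {}"
  shows "weight \<sigma> (hd q # p @ q) = \<sigma> (hd q) * \<sigma> (hd p) * weight \<sigma> p * weight \<sigma> q"
proof -
  have ne: "hd p \<in> set p" "hd q \<in> set q" using assms by (auto simp: good_def)
  have "set (wedges (hd q # p @ q)) =
      insert (edge (hd q) (hd p)) (set (wedges p) \<union> set (wedges q))"
    unfolding good_join(2)[OF assms] by auto
  moreover have "edge (hd q) (hd p) \<notin> set (wedges p) \<union> set (wedges q)"
    using wedges_subset[of p] wedges_subset[of q] ne assms(3)
      edge_mem_Times[of "hd q" "hd p" "set p"] edge_mem_Times[of "hd q" "hd p" "set q"] by blast
  moreover have "set (wedges p) \<inter> set (wedges q) = {}"
    using wedges_subset[of p] wedges_subset[of q] assms(3) by blast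
  moreover have "(case edge x y of (i, j) \<Rightarrow> \<sigma> i * \<sigma> j) = \<sigma> x * \<sigma> y" for x y
    by (auto simp: edge_def min_def max_def)
  ultimately show ?thesis
    by (simp add: weight_def prod.union_disjoint mult.assoc)
qed

text \<open>Surjectivity is \<open>goodE\<close>. The pieces can be read off the walk: q starts at
  the root and p avoids it, so p is what lies strictly between the first two visits to the
  root.\<close>

lemma good_walks_Suc_bij:
  "bij_betw (\<lambda>(i, p, q). hd q # p @ q)
     (SIGMA i:{..s}. {(p, q) \<in> good_walks n i \<times> good_walks n (s - i). set p \<inter> set q = {}})
     (good_walks n (Suc s))"
proof (rule bij_betw_imageI)
  have tw: "takeWhile (\<lambda>z. z \<noteq> hd q) (p @ q) = p" if "set p \<inter> set q = {}" "q \<noteq> []" for p q :: "nat list"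
    using that by (subst takeWhile_append2) (auto simp: takeWhile_eq_Nil_iff)
  show "inj_on (\<lambda>(i, p, q). hd q # p @ q)
     (SIGMA i:{..s}. {(p, q) \<in> good_walks n i \<times> good_walks n (s - i). set p \<inter> set q = {}})"
  proof (rule inj_onI, clarsimp)
    fix i p q i' p' q'
    assume p: "p \<in> good_walks n i" "p' \<in> good_walks n i'"
      and q: "q \<in> good_walks n (s - i)" "q' \<in> good_walks n (s - i')"
      and d: "set p \<inter> set q = {}" "set p' \<inter> set q' = {}"
      and eq: "hd q = hd q'" "p @ q = p' @ q'"
    have "p = p'"
      using tw[OF d(1) good_walksD(5)[OF q(1)]] tw[OF d(2) good_walksD(5)[OF q(2)]] eq by simp
    with eq good_walksD(2)[OF p(1)] good_walksD(2)[OF p(2)]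
    show "i = i' \<and> p = p' \<and> q = q'" by simp
  qed
  show "(\<lambda>(i, p, q). hd q # p @ q) `
     (SIGMA i:{..s}. {(p, q) \<in> good_walks n i \<times> good_walks n (s - i). set p \<inter> set q = {}}) =
     good_walks n (Suc s)"
  proof (intro equalityI subsetI)
    fix w assume "w \<in> (\<lambda>(i, p, q). hd q # p @ q) `
     (SIGMA i:{..s}. {(p, q) \<in> good_walks n i \<times> good_walks n (s - i). set p \<inter> set q = {}})"
    then obtain i p q where w: "w = hd q # p @ q" "i \<le> s" "p \<in> good_walks n i"
      "q \<in> good_walks n (s - i)" "set p \<inter> set q = {}" by auto
    note P = good_walksD[OF w(3)] and Q = good_walksD[OF w(4)]
    show "w \<in> good_walks n (Suc s)"
      using P Q w(2) good_join(1)[OF P(3) Q(3) w(5)] unfolding w(1)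
      by (intro good_walksI) auto
  next
    fix w assume w: "w \<in> good_walks n (Suc s)"
    note W = good_walksD[OF w]
    have "length w > 1" using W by simp
    with W(3) obtain x p q where x: "w = x # p @ q" "good p" "good q" "hd q = x"
      "set p \<inter> set q = {}" by (rule goodE)
    from good_odd_length[OF x(2)] obtain i where i: "length p = 2 * i + 1" by (rule oddE)
    have "length q = 2 * (s - i) + 1" "i \<le> s"
    proof -
      from good_odd_length[OF x(3)] obtain j where "length q = 2 * j + 1" by (rule oddE)
      then show "length q = 2 * (s - i) + 1" "i \<le> s" using W(2) i x(1) by auto
    qed
    then have "p \<in> good_walks n i" "q \<in> good_walks n (s - i)"
      using W(1) x i by (auto intro!: good_walksI)
    with x \<open>i \<le> s\<close> show "w \<in> (\<lambda>(i, p, q). hd q # p @ q) `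
     (SIGMA i:{..s}. {(p, q) \<in> good_walks n i \<times> good_walks n (s - i). set p \<inter> set q = {}})"
      by (intro image_eqI[of _ _ "(i, p, q)"]) auto
  qed
qed

section \<open>Asymptotics of sums over good walks for a bounded profile\<close>

locale bounded_profile =
  fixes \<sigma> \<Lambda> :: "nat \<Rightarrow> real" and K :: real
  assumes \<sigma>_nonneg: "\<And>i. i \<ge> 1 \<Longrightarrow> \<sigma> i \<ge> 0"
    and \<sigma>_le: "\<And>i. i \<ge> 1 \<Longrightarrow> \<sigma> i \<le> K"
    and averages: "\<And>k. k \<ge> 1 \<Longrightarrow> (\<lambda>n. (\<Sum>i=1..n. \<sigma> i ^ k) / real n) \<longlonglongrightarrow> \<Lambda> k"
begin

lemma K_nonneg: "K \<ge> 0"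
  using \<sigma>_nonneg[of 1] \<sigma>_le[of 1] by simp

lemma \<Lambda>_bound: "k \<ge> 1 \<Longrightarrow> \<bar>\<Lambda> k\<bar> \<le> K ^ k"
proof (rule tendsto_upperbound[OF tendsto_rabs[OF averages]])
  show "\<forall>\<^sub>F n in sequentially. \<bar>(\<Sum>i=1..n. \<sigma> i ^ k) / real n\<bar> \<le> K ^ k"
    using eventually_gt_at_top[of 0]
  proof eventually_elim
    case (elim n)
    have "\<bar>\<Sum>i=1..n. \<sigma> i ^ k\<bar> \<le> (\<Sum>i=1..n. K ^ k)"
      using \<sigma>_nonneg \<sigma>_le
      by (intro order_trans[OF sum_abs] sum_mono) (auto simp: power_abs intro!: power_mono)
    then show ?case using elim by (simp add: field_simps)
  qed
qed auto

text \<open>At most 2 s edges with two factors each. The base \<open>max 1 K\<close> is at least 1,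
  so exponents may be rounded up.\<close>

lemma weight_bound:
  assumes "w \<in> good_walks n s"
  shows "0 \<le> weight \<sigma> w" "weight \<sigma> w \<le> (max 1 K) ^ (4 * s)"
proof -
  have pos: "i \<ge> 1 \<and> j \<ge> 1" if "(i, j) \<in> set (wedges w)" for i j
    using that wedges_subset[of w] good_walksD(1)[OF assms] by auto
  then show "0 \<le> weight \<sigma> w"
    unfolding weight_def using \<sigma>_nonneg by (intro prod_nonneg) auto
  have "weight \<sigma> w \<le> (\<Prod>e\<in>set (wedges w). (max 1 K)\<^sup>2)"
    unfolding weight_def
  proof (rule prod_mono, clarsimp)
    fix i j assume "(i, j) \<in> set (wedges w)"
    with pos have "i \<ge> 1" "j \<ge> 1" by auto
    then have "\<sigma> i \<le> max 1 K" "\<sigma> j \<le> max 1 K" "\<sigma> i \<ge> 0" "\<sigma> j \<ge> 0"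
      using \<sigma>_le[of i] \<sigma>_le[of j] \<sigma>_nonneg by auto
    then show "0 \<le> \<sigma> i * \<sigma> j \<and> \<sigma> i * \<sigma> j \<le> (max 1 K)\<^sup>2"
      by (auto simp: power2_eq_square intro!: mult_mono)
  qed
  also have "\<dots> = (max 1 K) ^ (2 * card (set (wedges w)))" by (simp add: power_mult)
  also have "\<dots> \<le> (max 1 K) ^ (4 * s)"
    using card_length[of "wedges w"] good_walksD(2)[OF assms]
    by (intro power_increasing) (auto simp: length_wedges)
  finally show "weight \<sigma> w \<le> (max 1 K) ^ (4 * s)" .
qed

text \<open>The difference comes from pairs of walks that meet. Such a pair has at most s + 1
  vertices instead of s + 2, one power of n less than the main term.\<close>

lemma good_sum_Suc:
  assumes n: "n > 0"
  shows "\<bar>good_sum \<sigma> n (Suc s) h - (\<Sum>i\<le>s. good_sum \<sigma> n i 1 * good_sum \<sigma> n (s - i) (Suc h))\<bar>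
    \<le> real (Suc s) * real (Suc s ^ (2 * s + 2)) * max 1 K ^ (h + 2 + 4 * s) * real n ^ Suc s"
proof -
  let ?B = "max 1 K"
  let ?G = "\<lambda>i. good_walks n i \<times> good_walks n (s - i)"
  let ?D = "\<lambda>i. {(p, q) \<in> ?G i. set p \<inter> set q = {}}"
  let ?N = "\<lambda>i. {(p, q) \<in> ?G i. set p \<inter> set q \<noteq> {}}"
  \<comment> \<open>The joining edge contributes one factor at each root, giving order 1 at the root
    of p and raising h to \<open>Suc h\<close> at the root of q.\<close>
  define F where "F = (\<lambda>(p, q). (\<sigma> (hd p) ^ 1 * weight \<sigma> p) * (\<sigma> (hd q) ^ Suc h * weight \<sigma> q))"
  have fin: "finite (?G i)" for i by (simp add: finite_good_walks)
  have "good_sum \<sigma> n (Suc s) h =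
      (\<Sum>(i, p, q)\<in>Sigma {..s} ?D. \<sigma> (hd q) ^ h * weight \<sigma> (hd q # p @ q))"
    unfolding good_sum_def
    by (subst sum.reindex_bij_betw[OF good_walks_Suc_bij, symmetric]) (simp add: case_prod_unfold)
  also have "\<dots> = (\<Sum>(i, pq)\<in>Sigma {..s} ?D. F pq)"
    by (intro sum.cong) (auto simp: F_def weight_join dest!: good_walksD(3))
  also have "\<dots> = (\<Sum>i\<le>s. \<Sum>pq\<in>?D i. F pq)"
    using fin by (intro sum.Sigma[symmetric]) (auto intro: finite_subset[OF _ fin])
  finally have 1: "good_sum \<sigma> n (Suc s) h = (\<Sum>i\<le>s. \<Sum>pq\<in>?D i. F pq)" .
  have 2: "good_sum \<sigma> n i 1 * good_sum \<sigma> n (s - i) (Suc h) =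
      (\<Sum>pq\<in>?D i. F pq) + (\<Sum>pq\<in>?N i. F pq)" for i
  proof -
    have "good_sum \<sigma> n i 1 * good_sum \<sigma> n (s - i) (Suc h) = (\<Sum>pq\<in>?G i. F pq)"
      unfolding good_sum_def F_def sum_product sum.cartesian_product ..
    also have "?G i = ?D i \<union> ?N i" by auto
    also have "(\<Sum>pq\<in>?D i \<union> ?N i. F pq) = (\<Sum>pq\<in>?D i. F pq) + (\<Sum>pq\<in>?N i. F pq)"
      by (intro sum.union_disjoint finite_subset[OF _ fin[of i]]) auto
    finally show ?thesis .
  qed
  have cN: "card (?N i) \<le> Suc s ^ (2 * s + 2) * n ^ Suc s" if "i \<le> s" for i
  proof -
    \<comment> \<open>The length of p is fixed by i, so a pair can be recovered from its
      concatenation.\<close>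
    have "card (?N i) = card ((\<lambda>(p, q). p @ q) ` ?N i)"
      by (intro card_image[symmetric] inj_onI) (auto dest!: good_walksD(2))
    also have "\<dots> \<le> card {w. set w \<subseteq> {1..n} \<and> length w = 2 * s + 2 \<and> card (set w) \<le> Suc s}"
    proof (rule card_mono)
      show "finite {w. set w \<subseteq> {1..n} \<and> length w = 2 * s + 2 \<and> card (set w) \<le> Suc s}"
        by (rule finite_subset[OF _ finite_lists_length_eq[of "{1..n}" "2 * s + 2"]]) auto
      show "(\<lambda>(p, q). p @ q) ` ?N i \<subseteq> {w. set w \<subseteq> {1..n} \<and> length w = 2 * s + 2 \<and> card (set w) \<le> Suc s}"
      proof clarify
        fix p q assume p: "p \<in> good_walks n i" and q: "q \<in> good_walks n (s - i)"
          and d: "set p \<inter> set q \<noteq> {}"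
        note P = good_walksD[OF p] and Q = good_walksD[OF q]
        have "card (set p \<union> set q) + card (set p \<inter> set q) = s + 2"
          using P Q that card_Un_Int[of "set p" "set q"] by simp
        moreover have "card (set p \<inter> set q) \<ge> 1"
          using d by (simp add: Suc_le_eq card_gt_0_iff)
        ultimately show "set (p @ q) \<subseteq> {1..n} \<and> length (p @ q) = 2 * s + 2 \<and> card (set (p @ q)) \<le> Suc s"
          using P Q that by auto
      qed
    qed
    also have "\<dots> \<le> Suc s ^ (2 * s + 2) * n ^ Suc s" by (rule card_lists_few_values[OF n])
    finally show ?thesis .
  qed
  have FN: "\<bar>F pq\<bar> \<le> ?B ^ (h + 2 + 4 * s)" if pqN: "pq \<in> ?N i" and "i \<le> s" for i pq
  proof -
    obtain p q where pq: "pq = (p, q)" "p \<in> good_walks n i" "q \<in> good_walks n (s - i)"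
      using pqN by (cases pq) auto
    have B: "0 \<le> \<sigma> (hd w) \<and> \<sigma> (hd w) \<le> ?B" if "w \<in> good_walks n j" for w j
      using good_walksD(6)[OF that] \<sigma>_nonneg[of "hd w"] \<sigma>_le[of "hd w"] by auto
    note W = weight_bound[OF pq(2)] weight_bound[OF pq(3)]
    have "\<bar>F pq\<bar> = F pq" using B[OF pq(2)] B[OF pq(3)] W by (simp add: F_def pq(1))
    also have "\<dots> \<le> (?B ^ 1 * ?B ^ (4 * i)) * (?B ^ Suc h * ?B ^ (4 * (s - i)))"
      unfolding F_def pq(1) prod.case using B[OF pq(2)] B[OF pq(3)] W
      by (intro mult_mono power_mono mult_nonneg_nonneg zero_le_power) auto
    also have "\<dots> = ?B ^ (1 + 4 * i + (Suc h + 4 * (s - i)))" by (simp only: power_add)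
    also have "1 + 4 * i + (Suc h + 4 * (s - i)) = h + 2 + 4 * s" using that(2) by simp
    finally show ?thesis .
  qed
  have "\<bar>\<Sum>pq\<in>?N i. F pq\<bar> \<le> real (Suc s ^ (2 * s + 2) * n ^ Suc s) * ?B ^ (h + 2 + 4 * s)"
    if "i \<le> s" for i
  proof -
    have "\<bar>\<Sum>pq\<in>?N i. F pq\<bar> \<le> (\<Sum>pq\<in>?N i. ?B ^ (h + 2 + 4 * s))"
      using FN that by (intro order_trans[OF sum_abs] sum_mono) blast
    also have "\<dots> = real (card (?N i)) * ?B ^ (h + 2 + 4 * s)" by simp
    also have "\<dots> \<le> real (Suc s ^ (2 * s + 2) * n ^ Suc s) * ?B ^ (h + 2 + 4 * s)"
      using cN[OF that] by (intro mult_right_mono) (simp only: of_nat_le_iff, simp)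
    finally show ?thesis .
  qed
  note bound = this
  have "\<bar>good_sum \<sigma> n (Suc s) h - (\<Sum>i\<le>s. good_sum \<sigma> n i 1 * good_sum \<sigma> n (s - i) (Suc h))\<bar> =
      \<bar>\<Sum>i\<le>s. \<Sum>pq\<in>?N i. F pq\<bar>"
    unfolding 1 2 sum.distrib by simp
  also have "\<dots> \<le> (\<Sum>i\<le>s. \<bar>\<Sum>pq\<in>?N i. F pq\<bar>)" by (rule sum_abs)
  also have "\<dots> \<le> (\<Sum>i\<le>s. real (Suc s ^ (2 * s + 2) * n ^ Suc s) * ?B ^ (h + 2 + 4 * s))"
    using bound by (intro sum_mono) auto
  also have "\<dots> = real (Suc s) * real (Suc s ^ (2 * s + 2)) * ?B ^ (h + 2 + 4 * s) * real n ^ Suc s"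
    by (simp only: sum_constant card_atMost of_nat_mult of_nat_power mult_ac)
  finally show ?thesis .
qed

text \<open>All h are treated at once because the recursion raises h. The powers of n match, as (i +
  1) + (r - i + 1) = r + 2.\<close>

lemma good_sum_tendsto:
  "(\<lambda>n. good_sum \<sigma> n s h / real n ^ Suc s) \<longlonglongrightarrow> tree_moment \<Lambda> s h"
proof (induction s arbitrary: h rule: less_induct)
  case (less s)
  show ?case
  proof (cases s)
    case 0
    have eq: "good_sum \<sigma> n 0 h = (\<Sum>i=1..n. \<sigma> i ^ h)" for n
      unfolding good_sum_def good_walks_0 by (subst sum.reindex) (auto simp: inj_on_def weight_def)
    show ?thesis
    proof (cases "h = 0")
      case True
      have "\<forall>\<^sub>F n in sequentially. real n / real n = 1"
        using eventually_gt_at_top[of 0] by eventually_elim simp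
      moreover have "good_sum \<sigma> n s h / real n ^ Suc s = real n / real n" for n
        unfolding 0 eq by (simp add: True)
      moreover have "tree_moment \<Lambda> s h = 1" by (simp add: 0 True)
      ultimately show ?thesis by (simp only: tendsto_eventually)
    next
      case False
      then show ?thesis using averages[of h] unfolding 0 eq by simp
    qed
  next
    case (Suc r)
    define A where "A n = (\<Sum>i\<le>r. good_sum \<sigma> n i 1 * good_sum \<sigma> n (r - i) (Suc h))" for n
    define c where "c = real (Suc r) * real (Suc r ^ (2 * r + 2)) * max 1 K ^ (h + 2 + 4 * r)"
    have "(\<lambda>n. \<Sum>i\<le>r. (good_sum \<sigma> n i 1 / real n ^ Suc i) *
        (good_sum \<sigma> n (r - i) (Suc h) / real n ^ Suc (r - i))) \<longlonglongrightarrow> tree_moment \<Lambda> s h"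
      unfolding Suc tree_moment.simps using less Suc by (intro tendsto_sum tendsto_mult) auto
    moreover have "(\<Sum>i\<le>r. (good_sum \<sigma> n i 1 / real n ^ Suc i) *
        (good_sum \<sigma> n (r - i) (Suc h) / real n ^ Suc (r - i))) = A n / real n ^ Suc s" for n
      unfolding A_def sum_divide_distrib times_divide_times_eq power_add[symmetric]
      by (intro sum.cong) (auto simp: Suc)
    ultimately have 1: "(\<lambda>n. A n / real n ^ Suc s) \<longlonglongrightarrow> tree_moment \<Lambda> s h" by simp
    have "(\<lambda>n. (good_sum \<sigma> n s h - A n) / real n ^ Suc s) \<longlonglongrightarrow> 0"
    proof (rule Lim_null_comparison)
      show "\<forall>\<^sub>F n in sequentially. norm ((good_sum \<sigma> n s h - A n) / real n ^ Suc s) \<le> c / real n"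
        using eventually_gt_at_top[of 0]
      proof eventually_elim
        case (elim n)
        have "\<bar>good_sum \<sigma> n s h - A n\<bar> \<le> c * real n ^ s"
          unfolding Suc A_def c_def by (rule good_sum_Suc[OF elim])
        then show ?case using elim by (simp add: field_simps)
      qed
      show "(\<lambda>n. c / real n) \<longlonglongrightarrow> 0" by (rule lim_const_over_n)
    qed
    from tendsto_add[OF this 1] show ?thesis by (simp flip: add_divide_distrib)
  qed
qed

end

section \<open>Convergence of moments\<close>

text \<open>A single law enters as a constant sequence, so limit and approximating laws fall under
  the same lemmas. Only the limiting moments are bounded, not those of each law.\<close>

locale convergent_moments =
  fixes \<nu> :: "nat \<Rightarrow> real measure" and m :: "nat \<Rightarrow> real" and C :: real
  assumes distr: "\<And>n. real_distribution (\<nu> n)"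
    and moments: "\<And>n k. integrable (\<nu> n) (\<lambda>x. x ^ k)"
    and lim: "\<And>k. (\<lambda>n. LINT x|\<nu> n. x ^ k) \<longlonglongrightarrow> m k"
    and C: "C \<ge> 0" and bound: "\<And>s. s \<ge> 1 \<Longrightarrow> m (2 * s) \<le> C ^ (2 * s)"
begin

text \<open>In the limit the integral of (x / R)^(2 s) is at most (C / R)^(2 s), which is small for
  large s. So s is chosen first, depending on e' - e, and n tends to infinity afterwards; hence the
  domination is required for all large s.\<close>

lemma integral_eventually_less:
  assumes g: "g \<in> borel_measurable borel" and R: "C < R" and e: "e < e'" and D: "D \<ge> 0"
    and le: "\<And>s x. s \<ge> s0 \<Longrightarrow> \<bar>g x\<bar> \<le> e + D * (x / R) ^ (2 * s)"
  shows "\<forall>\<^sub>F n in sequentially. integrable (\<nu> n) g \<and> \<bar>LINT x|\<nu> n. g x\<bar> < e'"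
proof -
  have R0: "R > 0" using R C by simp
  have "(\<lambda>s. D * ((C / R)\<^sup>2) ^ s) \<longlonglongrightarrow> D * 0"
    using R0 R C by (intro tendsto_mult tendsto_const LIMSEQ_power_zero) (auto simp: power_less_one_iff abs_square_less_1)
  then have "\<forall>\<^sub>F s in sequentially. D * ((C / R)\<^sup>2) ^ s < e' - e"
    using e by (intro order_tendstoD) auto
  then obtain s where s: "s \<ge> s0" "s \<ge> 1" "D * ((C / R)\<^sup>2) ^ s < e' - e"
    using eventually_happens'[OF sequentially_bot, OF eventually_conj[OF eventually_conj[OF
          eventually_ge_at_top[of s0] eventually_ge_at_top[of 1]]]] by auto
  let ?h = "\<lambda>x. e + D / R ^ (2 * s) * x ^ (2 * s)"
  have gh: "\<bar>g x\<bar> \<le> ?h x" for x using le[OF s(1), of x] by (simp add: power_divide)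
  have ih: "integrable (\<nu> n) ?h" and ig: "integrable (\<nu> n) g" for n
  proof -
    interpret real_distribution "\<nu> n" by (rule distr)
    show ih: "integrable (\<nu> n) ?h"
      by (intro Bochner_Integration.integrable_add integrable_mult_right moments integrable_const)
    show "integrable (\<nu> n) g"
    proof (rule Bochner_Integration.integrable_bound[OF ih])
      show "AE x in \<nu> n. norm (g x) \<le> norm (?h x)"
        using gh by (intro AE_I2) (metis abs_ge_self order_trans real_norm_def)
    qed (rule measurable_finite_borel[OF g])
  qed
  have le': "\<bar>LINT x|\<nu> n. g x\<bar> \<le> e + D / R ^ (2 * s) * (LINT x|\<nu> n. x ^ (2 * s))" for n
  proof -
    interpret real_distribution "\<nu> n" by (rule distr)
    have "\<bar>LINT x|\<nu> n. g x\<bar> \<le> (LINT x|\<nu> n. \<bar>g x\<bar>)"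
      using integral_norm_bound[of "\<nu> n" g] by simp
    also have "\<dots> \<le> (LINT x|\<nu> n. ?h x)"
      using ig ih gh by (intro integral_mono) auto
    also have "\<dots> = e + D / R ^ (2 * s) * (LINT x|\<nu> n. x ^ (2 * s))"
      using moments[of n "2 * s"] by (simp add: prob_space[unfolded space_eq_univ])
    finally show ?thesis .
  qed
  have lim': "(\<lambda>n. e + D / R ^ (2 * s) * (LINT x|\<nu> n. x ^ (2 * s))) \<longlonglongrightarrow>
      e + D / R ^ (2 * s) * m (2 * s)"
    by (intro tendsto_intros lim)
  have less: "e + D / R ^ (2 * s) * m (2 * s) < e'"
  proof -
    have "D / R ^ (2 * s) * m (2 * s) \<le> D / R ^ (2 * s) * C ^ (2 * s)"
      using bound[OF s(2)] D R0 by (intro mult_left_mono) auto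
    also have "\<dots> = D * ((C / R)\<^sup>2) ^ s" by (simp add: power_divide flip: power_mult)
    finally show ?thesis using s(3) by simp
  qed
  from order_tendstoD(2)[OF lim' less] show ?thesis
    by eventually_elim (intro conjI ig le_less_trans[OF le'])
qed

end

text \<open>Supplies the domination required by \<open>integral_eventually_less\<close> outside
  [-R, R].\<close>

lemma power_le_tail:
  fixes x R :: real
  assumes "R \<ge> 1" "\<bar>x\<bar> > R" "k \<le> 2 * s"
  shows "\<bar>x\<bar> ^ k \<le> R ^ k * (x / R) ^ (2 * s)"
proof -
  have "(\<bar>x\<bar> / R) ^ k \<le> (\<bar>x\<bar> / R) ^ (2 * s)"
    using assms by (intro power_increasing) auto
  also have "\<dots> = (x / R) ^ (2 * s)" using assms(1) by (simp add: power_divide power_even_abs)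
  finally show ?thesis using assms by (simp add: power_divide field_simps)
qed

text \<open>The polynomial depends on \<open>f\<close>, \<open>C\<close> and \<open>e\<close> only, so that it serves the approximating
  sequence and its limit simultaneously.\<close>

lemma polynomial_approximation:
  fixes f :: "real \<Rightarrow> real"
  assumes f: "continuous_on UNIV f" and B: "\<And>x. \<bar>f x\<bar> \<le> B" and C: "C \<ge> 0" and e: "e > 0"
  obtains a d where "\<And>\<nu> m. convergent_moments \<nu> m C \<Longrightarrow>
    \<forall>\<^sub>F n in sequentially. \<bar>(LINT x|\<nu> n. f x) - (\<Sum>i\<le>d. a i * (LINT x|\<nu> n. x ^ i))\<bar> < e"
proof -
  \<comment> \<open>The tail needs R > C; in addition R \<ge> 1 lets |x|^d dominate the lower powers
    outside [-R, R].\<close>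
  define R where "R = C + 1"
  have R: "R \<ge> 1" "C < R" using C by (auto simp: R_def)
  have "continuous_on {-R..R} f" using f continuous_on_subset by blast
  then obtain p where p: "polynomial_function p" "\<And>x. x \<in> {-R..R} \<Longrightarrow> norm (f x - p x) < e / 2"
    using Stone_Weierstrass_polynomial_function[of "{-R..R}" f "e / 2"] e by (auto simp: compact_Icc)
  obtain a d where ad: "p = (\<lambda>x. \<Sum>i\<le>d. a i * x ^ i)"
    using p(1) real_polynomial_function_iff_sum[of p] by (auto simp: real_polynomial_function_eq)
  \<comment> \<open>Outside the interval |f - p| is at most (B + sum of |a_i|) |x|^d, and
    \<open>power_le_tail\<close> replaces |x|^d at the cost of R^d.\<close>
  define D where "D = (B + (\<Sum>i\<le>d. \<bar>a i\<bar>)) * R ^ d"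
  have B0: "B \<ge> 0" using B[of 0] by simp
  have D0: "D \<ge> 0" using B0 R by (auto simp: D_def intro!: mult_nonneg_nonneg add_nonneg_nonneg sum_nonneg)
  have le: "\<bar>f x - p x\<bar> \<le> e / 2 + D * (x / R) ^ (2 * s)" if s: "s \<ge> d" for s x
  proof (cases "\<bar>x\<bar> \<le> R")
    case True
    then have "\<bar>f x - p x\<bar> < e / 2" using p(2)[of x] by (auto simp: abs_le_iff)
    moreover have "D * (x / R) ^ (2 * s) \<ge> 0" using D0 by simp
    ultimately show ?thesis by linarith
  next
    case False
    then have x1: "\<bar>x\<bar> \<ge> 1" using R by simp
    have "\<bar>p x\<bar> \<le> (\<Sum>i\<le>d. \<bar>a i * x ^ i\<bar>)" unfolding ad by (rule sum_abs)
    also have "\<dots> \<le> (\<Sum>i\<le>d. \<bar>a i\<bar> * \<bar>x\<bar> ^ d)"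
      using x1 by (intro sum_mono) (auto simp: abs_mult power_abs intro!: mult_left_mono power_increasing)
    finally have "\<bar>p x\<bar> \<le> (\<Sum>i\<le>d. \<bar>a i\<bar>) * \<bar>x\<bar> ^ d" by (simp add: sum_distrib_right)
    moreover have "\<bar>f x\<bar> \<le> B * \<bar>x\<bar> ^ d"
      using B[of x] B0 x1 mult_left_mono[of 1 "\<bar>x\<bar> ^ d" B] by (simp add: one_le_power)
    ultimately have "\<bar>f x - p x\<bar> \<le> (B + (\<Sum>i\<le>d. \<bar>a i\<bar>)) * \<bar>x\<bar> ^ d"
      by (simp add: distrib_right)
    also have "\<dots> \<le> (B + (\<Sum>i\<le>d. \<bar>a i\<bar>)) * (R ^ d * (x / R) ^ (2 * s))"
      using False R s B0 by (intro mult_left_mono power_le_tail add_nonneg_nonneg sum_nonneg) auto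
    also have "\<dots> = D * (x / R) ^ (2 * s)" by (simp add: D_def)
    finally show ?thesis using e by simp
  qed
  have fm: "f \<in> borel_measurable borel" using f by (rule borel_measurable_continuous_onI)
  show thesis
  proof (rule that)
    fix \<nu> m assume "convergent_moments \<nu> m C"
    then interpret convergent_moments \<nu> m C .
    have "(\<lambda>x. f x - p x) \<in> borel_measurable borel"
      unfolding ad using fm by measurable
    from integral_eventually_less[OF this R(2) _ D0 le, of e]
    have "\<forall>\<^sub>F n in sequentially. integrable (\<nu> n) (\<lambda>x. f x - p x) \<and> \<bar>LINT x|\<nu> n. f x - p x\<bar> < e"
      using e by auto
    then show "\<forall>\<^sub>F n in sequentially.
        \<bar>(LINT x|\<nu> n. f x) - (\<Sum>i\<le>d. a i * (LINT x|\<nu> n. x ^ i))\<bar> < e"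
    proof eventually_elim
      case (elim n)
      interpret real_distribution "\<nu> n" by (rule distr)
      have ip: "integrable (\<nu> n) p" unfolding ad using moments by auto
      have "integrable (\<nu> n) (\<lambda>x. (f x - p x) + p x)"
        using elim ip by (intro Bochner_Integration.integrable_add) auto
      then have "integrable (\<nu> n) f" by simp
      then have "(LINT x|\<nu> n. f x - p x) = (LINT x|\<nu> n. f x) - (LINT x|\<nu> n. p x)"
        using ip by (rule Bochner_Integration.integral_diff)
      also have "(LINT x|\<nu> n. p x) = (\<Sum>i\<le>d. a i * (LINT x|\<nu> n. x ^ i))"
        unfolding ad using moments by simp
      finally show ?case using elim by simp
    qed
  qed
qed

text \<open>An e/3 argument: the same polynomial approximates f for both sequences, and its
  integrals converge because the moments do. Applied to two constant sequences it yields uniqueness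
  of the law.\<close>

lemma moments_imp_weak_convergence:
  fixes f :: "real \<Rightarrow> real"
  assumes f: "continuous_on UNIV f" "bounded (range f)"
    and \<nu>: "convergent_moments \<nu> m C" and \<mu>: "convergent_moments (\<lambda>_. \<mu>) m C"
  shows "(\<lambda>n. LINT x|\<nu> n. f x) \<longlonglongrightarrow> (LINT x|\<mu>. f x)"
proof (rule tendstoI)
  fix e :: real assume e: "e > 0"
  obtain B where B: "\<And>x. \<bar>f x\<bar> \<le> B" using f(2) by (auto simp: bounded_iff)
  have C: "C \<ge> 0" using \<nu> by (simp add: convergent_moments_def)
  obtain a d where ad: "\<And>\<nu> m. convergent_moments \<nu> m C \<Longrightarrow>
      \<forall>\<^sub>F n in sequentially. \<bar>(LINT x|\<nu> n. f x) - (\<Sum>i\<le>d. a i * (LINT x|\<nu> n. x ^ i))\<bar> < e / 3"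
    using polynomial_approximation[OF f(1) B C, of "e / 3"] e by auto
  have lim: "(\<lambda>n. LINT x|\<nu> n. x ^ k) \<longlonglongrightarrow> m k" for k using \<nu> by (simp add: convergent_moments_def)
  have "(LINT x|\<mu>. x ^ k) = m k" for k
    using \<mu> LIMSEQ_unique[OF tendsto_const] by (auto simp: convergent_moments_def)
  then have "(\<lambda>n. \<Sum>i\<le>d. a i * (LINT x|\<nu> n. x ^ i)) \<longlonglongrightarrow> (\<Sum>i\<le>d. a i * (LINT x|\<mu>. x ^ i))"
    by (auto intro!: tendsto_intros lim)
  from tendstoD[OF this, of "e / 3"] e have "\<forall>\<^sub>F n in sequentially.
      dist (\<Sum>i\<le>d. a i * (LINT x|\<nu> n. x ^ i)) (\<Sum>i\<le>d. a i * (LINT x|\<mu>. x ^ i)) < e / 3" by simp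
  with ad[OF \<nu>] ad[OF \<mu>]
  show "\<forall>\<^sub>F n in sequentially. dist (LINT x|\<nu> n. f x) (LINT x|\<mu>. f x) < e"
  proof eventually_elim
    case (elim n)
    then show ?case unfolding dist_real_def abs_less_iff by argo
  qed
qed

context convergent_moments
begin

lemma tight: "tight \<nu>"
  unfolding tight_def
proof (intro conjI allI impI distr)
  fix e :: real assume e: "e > 0"
  have "Bseq (\<lambda>n. LINT x|\<nu> n. x ^ 2)" using lim[of 2] convergent_imp_Bseq convergentI by blast
  then obtain V where V: "V > 0" "\<And>n. \<bar>LINT x|\<nu> n. x ^ 2\<bar> \<le> V" by (auto simp: Bseq_def)
  \<comment> \<open>Markov's inequality for x^2 asks for V / R^2 < e; the added 1 makes this
    strict.\<close>
  define R where "R = sqrt (V / e) + 1"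
  have R: "R > 0" "V / R\<^sup>2 < e"
  proof -
    have "sqrt (V / e) \<ge> 0" using V e by simp
    then show R0: "R > 0" unfolding R_def by linarith
    have "V / e = (sqrt (V / e))\<^sup>2" using V e by simp
    also have "\<dots> < R\<^sup>2" using \<open>sqrt (V / e) \<ge> 0\<close> by (intro power_strict_mono) (auto simp: R_def)
    finally show "V / R\<^sup>2 < e" using e R0 by (simp add: field_simps)
  qed
  show "\<exists>a b. a < b \<and> (\<forall>n. 1 - e < measure (\<nu> n) {a<..b})"
  proof (rule exI[of _ "-R"], rule exI[of _ R], intro conjI allI)
    show "- R < R" using R by simp
    fix n
    interpret real_distribution "\<nu> n" by (rule distr)
    have "measure (\<nu> n) {x \<in> space (\<nu> n). R\<^sup>2 \<le> x\<^sup>2} \<le> (LINT x|\<nu> n. x\<^sup>2) / R\<^sup>2"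
      using R moments[of n 2] by (intro integral_Markov_inequality_measure[where A="space (\<nu> n)", simplified]) auto
    also have "\<dots> \<le> V / R\<^sup>2" using V(2)[of n] by (intro divide_right_mono) auto
    also have "\<dots> < e" by (rule R)
    finally have "measure (\<nu> n) {x. R\<^sup>2 \<le> x\<^sup>2} < e" by simp
    moreover have "measure (\<nu> n) (- {-R<..R}) \<le> measure (\<nu> n) {x. R\<^sup>2 \<le> x\<^sup>2}"
    proof (rule finite_measure_mono)
      have "R\<^sup>2 \<le> x\<^sup>2" if "\<not> (- R < x \<and> x \<le> R)" for x
        using that R by (intro power2_le_iff_abs_le[THEN iffD2] abs_le_square_iff[THEN iffD1]) auto
      then show "- {-R<..R} \<subseteq> {x. R\<^sup>2 \<le> x\<^sup>2}" by auto
      show "{x. R\<^sup>2 \<le> x\<^sup>2} \<in> events" by measurable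
    qed
    moreover have "measure (\<nu> n) (- {-R<..R}) = 1 - measure (\<nu> n) {-R<..R}"
      using prob_compl[of "{-R<..R}"] by (simp add: Compl_eq_Diff_UNIV)
    ultimately show "1 - e < measure (\<nu> n) {-R<..R}" by simp
  qed
qed

text \<open>Weak convergence along a subsequence controls only bounded test functions. So the limit
  is first shown to live on [-R, R], where powers agree with truncated ones; the truncation error
  for the sequence vanishes by \<open>integral_eventually_less\<close>.\<close>

lemma limit_distribution_exists:
  obtains \<mu> where "real_distribution \<mu>" "convergent_moments (\<lambda>_. \<mu>) m C"
proof -
  obtain r \<mu> where r: "strict_mono r" and \<mu>: "real_distribution \<mu>" and wc: "weak_conv_m (\<nu> \<circ> id \<circ> r) \<mu>"
    using tight_imp_convergent_subsubsequence[OF tight, of id] by (auto simp: strict_mono_id)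
  interpret \<mu>: real_distribution \<mu> by (rule \<mu>)
  define R where "R = C + 1"
  have R: "R \<ge> 1" "C < R" and R0: "R \<ge> 0" using C by (auto simp: R_def)
  have sub: "(\<lambda>n. LINT x|\<nu> (r n). g x) \<longlonglongrightarrow> (LINT x|\<mu>. g x)"
    if "continuous_on UNIV g" "\<And>x. \<bar>g x\<bar> \<le> B" for g :: "real \<Rightarrow> real" and B
    using weak_conv_imp_integral_bdd_continuous_conv[of "\<nu> \<circ> id \<circ> r" \<mu> g B] wc distr \<mu> that
    by (auto simp: continuous_on_eq_continuous_at)
  have small: "(LINT x|\<mu>. g x) = c"
    if "continuous_on UNIV g" "\<And>x. \<bar>g x\<bar> \<le> B" "(\<lambda>n. LINT x|\<nu> n. g x) \<longlonglongrightarrow> c"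
    for g :: "real \<Rightarrow> real" and B c
    using LIMSEQ_unique[OF sub[OF that(1,2)]] LIMSEQ_subseq_LIMSEQ[OF that(3) r] by (simp add: comp_def)
  \<comment> \<open>A bounded continuous ramp that vanishes exactly on [-R, R]: integral zero means
    no mass outside.\<close>
  define g where "g x = min 1 (max 0 (\<bar>x\<bar> - R))" for x :: real
  have gc: "continuous_on UNIV g" unfolding g_def by (intro continuous_intros)
  have g0: "g x \<ge> 0" for x by (simp add: g_def)
  have "(LINT x|\<mu>. g x) = 0"
  proof (rule small[OF gc])
    show "\<bar>g x\<bar> \<le> 1" for x by (simp add: g_def)
    show "(\<lambda>n. LINT x|\<nu> n. g x) \<longlonglongrightarrow> 0"
    proof (rule tendstoI)
      fix e :: real assume e: "e > 0"
      have "\<bar>g x\<bar> \<le> 0 + 1 * (x / R) ^ (2 * s)" if "s \<ge> 0" for s x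
        using power_le_tail[of R x 0 s] R by (cases "\<bar>x\<bar> > R") (auto simp: g_def)
      from integral_eventually_less[OF borel_measurable_continuous_onI[OF gc] R(2) e _ this]
      show "\<forall>\<^sub>F n in sequentially. dist (LINT x|\<nu> n. g x) 0 < e"
        by (auto elim: eventually_mono)
    qed
  qed
  moreover have "integrable \<mu> g"
  proof (rule \<mu>.integrable_const_bound[of _ 1])
    show "g \<in> borel_measurable \<mu>"
      by (intro \<mu>.measurable_finite_borel borel_measurable_continuous_onI[OF gc])
  qed (auto simp: g_def)
  ultimately have "AE x in \<mu>. g x = 0"
    using integral_nonneg_eq_0_iff_AE[of \<mu> g] g0 by simp
  then have ae: "AE x in \<mu>. \<bar>x\<bar> \<le> R" by eventually_elim (auto simp: g_def min_def max_def split: if_splits)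
  have int: "integrable \<mu> (\<lambda>x. x ^ k)" for k
  proof (rule \<mu>.integrable_const_bound[of _ "R ^ k"])
    show "AE x in \<mu>. norm (x ^ k) \<le> R ^ k"
      using ae by eventually_elim (auto intro: power_mono simp: power_abs)
  qed simp
  have mom: "(LINT x|\<mu>. x ^ k) = m k" for k
  proof -
    \<comment> \<open>Clamping x to [-R, R] before taking the power gives a bounded continuous
      function.\<close>
    define h where "h x = (max (-R) (min R x)) ^ k" for x :: real
    have hc: "continuous_on UNIV h" unfolding h_def by (intro continuous_intros)
    have h_eq: "h x = x ^ k" if "\<bar>x\<bar> \<le> R" for x
    proof -
      have "max (-R) (min R x) = x" using that by linarith
      then show ?thesis by (simp add: h_def)
    qed
    have hR: "\<bar>h x\<bar> \<le> R ^ k" for x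
      unfolding h_def power_abs using R by (intro power_mono) auto
    have hx: "\<bar>h x\<bar> \<le> \<bar>x\<bar> ^ k" for x
      unfolding h_def power_abs using R by (intro power_mono) auto
    have "(LINT x|\<mu>. h x) = m k"
    proof (rule small[OF hc])
      show "\<bar>h x\<bar> \<le> R ^ k" for x by (rule hR)
      have "(\<lambda>n. LINT x|\<nu> n. h x - x ^ k) \<longlonglongrightarrow> 0"
      proof (rule tendstoI)
        fix e :: real assume e: "e > 0"
        have bnd: "\<bar>h x - x ^ k\<bar> \<le> 0 + 2 * R ^ k * (x / R) ^ (2 * s)" if s: "s \<ge> k" for s x
        proof (cases "\<bar>x\<bar> > R")
          case True
          have "\<bar>h x - x ^ k\<bar> \<le> 2 * \<bar>x\<bar> ^ k"
            using hx[of x] abs_triangle_ineq4[of "h x" "x ^ k"] by (simp add: power_abs)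
          also have "\<dots> \<le> 2 * (R ^ k * (x / R) ^ (2 * s))"
            using power_le_tail[OF R(1) True, of k s] s by (intro mult_left_mono) auto
          finally show ?thesis by (simp only: mult.assoc add_0)
        next
          case False
          then have "h x = x ^ k" by (intro h_eq) simp
          moreover have "2 * R ^ k * (x / R) ^ (2 * s) \<ge> 0"
            by (intro mult_nonneg_nonneg zero_le_power R0 zero_le_even_power[of "2 * s"]) simp_all
          ultimately show ?thesis unfolding \<open>h x = x ^ k\<close> diff_self abs_zero add_0 by -
        qed
        have meas: "(\<lambda>x. h x - x ^ k) \<in> borel_measurable borel"
          by (intro borel_measurable_diff borel_measurable_continuous_onI[OF hc]) simp
        have "\<forall>\<^sub>F n in sequentially. integrable (\<nu> n) (\<lambda>x. h x - x ^ k) \<and> \<bar>LINT x|\<nu> n. h x - x ^ k\<bar> < e"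
          using R0 by (intro integral_eventually_less[OF meas R(2) e _ bnd]) simp_all
        then show "\<forall>\<^sub>F n in sequentially. dist (LINT x|\<nu> n. h x - x ^ k) 0 < e"
          by (auto elim: eventually_mono)
      qed
      from tendsto_add[OF this lim[of k]]
      have "(\<lambda>n. (LINT x|\<nu> n. h x - x ^ k) + (LINT x|\<nu> n. x ^ k)) \<longlonglongrightarrow> m k" by simp
      moreover have "(LINT x|\<nu> n. h x - x ^ k) + (LINT x|\<nu> n. x ^ k) = (LINT x|\<nu> n. h x)" for n
      proof -
        interpret real_distribution "\<nu> n" by (rule distr)
        have "integrable (\<nu> n) h"
          using hR
          by (intro integrable_const_bound[of _ "R ^ k"] AE_I2 measurable_finite_borel
              borel_measurable_continuous_onI[OF hc]) simp
        then show ?thesis using moments[of n k] by simp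
      qed
      ultimately show "(\<lambda>n. LINT x|\<nu> n. h x) \<longlonglongrightarrow> m k" by simp
    qed
    moreover have "(LINT x|\<mu>. h x) = (LINT x|\<mu>. x ^ k)"
    proof (rule integral_cong_AE)
      show "AE x in \<mu>. h x = x ^ k"
        using ae by eventually_elim (rule h_eq)
    qed (auto intro: \<mu>.measurable_finite_borel borel_measurable_continuous_onI[OF hc])
    ultimately show ?thesis by simp
  qed
  have "convergent_moments (\<lambda>_. \<mu>) m C"
    using \<mu> int mom C bound by unfold_locales auto
  with \<mu> that show thesis by blast
qed

end

section \<open>Random matrices\<close>

lemma prod_list_count:
  fixes f :: "'a \<Rightarrow> 'b :: comm_monoid_mult"
  shows "(\<Prod>e\<leftarrow>L. f e) = (\<Prod>e\<in>set L. f e ^ count_list L e)"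
proof -
  have "(\<Prod>e\<leftarrow>L. f e) = prod_mset (image_mset f (mset L))"
    by (simp add: prod_mset_prod_list flip: mset_map)
  then show ?thesis by (simp add: image_prod_mset_multiplicity count_mset)
qed

text \<open>Order n^-2 makes the Chebyshev bounds summable for each tolerance. The tolerances 1 / (j
  + 1) are countable, so their exceptional sets can be united.\<close>

lemma (in prob_space) AE_tendsto_of_variance:
  fixes X :: "nat \<Rightarrow> 'a \<Rightarrow> real"
  assumes X: "\<And>n. random_variable borel (X n)" "\<And>n. integrable M (\<lambda>\<omega>. (X n \<omega>)\<^sup>2)"
    and var: "\<And>n. variance (X n) \<le> C / real (Suc n) ^ 2"
    and lim: "(\<lambda>n. expectation (X n)) \<longlonglongrightarrow> c"
  shows "AE \<omega> in M. (\<lambda>n. X n \<omega>) \<longlonglongrightarrow> c"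
proof -
  have "AE \<omega> in M. \<forall>\<^sub>F n in sequentially. \<bar>X n \<omega> - expectation (X n)\<bar> < 1 / real (Suc j)" for j
  proof -
    define d where "d = 1 / real (Suc j)"
    have d: "d > 0" by (simp add: d_def)
    define A where "A n = {\<omega> \<in> space M. d \<le> \<bar>X n \<omega> - expectation (X n)\<bar>}" for n
    have A: "A n \<in> events" for n unfolding A_def using X by measurable
    have "summable (\<lambda>n. measure M (A n))"
    proof (rule summable_comparison_test')
      have "summable (\<lambda>n. C / d\<^sup>2 * inverse (real (Suc n) ^ 2))"
        by (intro summable_mult) (rule summable_Suc_iff[THEN iffD2, OF inverse_power_summable], simp)
      then show "summable (\<lambda>n. C / d\<^sup>2 * inverse (real (Suc n) ^ 2))" .
      fix n :: nat
      have "measure M (A n) \<le> variance (X n) / d\<^sup>2"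
        unfolding A_def using X d by (intro Chebyshev_inequality)
      also have "\<dots> \<le> (C / real (Suc n) ^ 2) / d\<^sup>2" by (intro divide_right_mono var) simp
      finally show "norm (measure M (A n)) \<le> C / d\<^sup>2 * inverse (real (Suc n) ^ 2)"
        by (simp add: field_simps)
    qed
    then have "AE \<omega> in M. \<forall>\<^sub>F n in sequentially. \<omega> \<in> space M - A n"
      using A by (intro borel_cantelli_AE1) (auto simp: emeasure_eq_measure)
    then show ?thesis
    proof eventually_elim
      case (elim \<omega>)
      then show ?case by eventually_elim (auto simp: A_def d_def)
    qed
  qed
  then have "AE \<omega> in M. \<forall>j. \<forall>\<^sub>F n in sequentially. \<bar>X n \<omega> - expectation (X n)\<bar> < 1 / real (Suc j)"
    by (simp add: AE_all_countable)
  then show ?thesis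
  proof eventually_elim
    case (elim \<omega>)
    have "(\<lambda>n. X n \<omega> - expectation (X n)) \<longlonglongrightarrow> 0"
    proof (rule tendstoI)
      fix e :: real assume "e > 0"
      then obtain j where "1 / real (Suc j) < e" using nat_approx_posE by auto
      with elim[rule_format, of j]
      show "\<forall>\<^sub>F n in sequentially. dist (X n \<omega> - expectation (X n)) 0 < e"
        by (auto elim: eventually_mono)
    qed
    from tendsto_add[OF this lim] show ?case by simp
  qed
qed

lemma (in prob_space) abs_expectation_le:
  fixes X :: "'a \<Rightarrow> real"
  assumes "integrable M X" "AE \<omega> in M. \<bar>X \<omega>\<bar> \<le> B"
  shows "\<bar>expectation X\<bar> \<le> B"
proof -
  have "\<bar>expectation X\<bar> \<le> expectation (\<lambda>\<omega>. \<bar>X \<omega>\<bar>)"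
    using integral_norm_bound[of M X] by simp
  also have "\<dots> \<le> expectation (\<lambda>_. B)"
    using assms by (intro integral_mono_AE) auto
  finally show ?thesis by (simp add: prob_space)
qed

locale bounded_wigner = prob_space M for M :: "'w measure" +
  fixes a :: "nat \<Rightarrow> nat \<Rightarrow> 'w \<Rightarrow> real" and \<sigma> \<Lambda> :: "nat \<Rightarrow> real" and K :: real
  assumes \<sigma>_pos: "\<And>i. i \<ge> 1 \<Longrightarrow> \<sigma> i > 0"
    and indep: "indep_vars (\<lambda>_. borel) (\<lambda>(i, j). a i j) {(i, j). 1 \<le> i \<and> i \<le> j}"
    and symmetric: "\<And>i j \<omega>. i \<ge> 1 \<Longrightarrow> j \<ge> 1 \<Longrightarrow> \<omega> \<in> space M \<Longrightarrow> a j i \<omega> = a i j \<omega>"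
    and mean: "\<And>i j. i \<ge> 1 \<Longrightarrow> j \<ge> 1 \<Longrightarrow> expectation (a i j) = 0"
    and K_pos: "K > 0"
    and bounded: "\<And>i j. i \<ge> 1 \<Longrightarrow> j \<ge> 1 \<Longrightarrow> prob {\<omega> \<in> space M. \<bar>a i j \<omega>\<bar> < K} = 1"
    and variance: "\<And>i j. i \<ge> 1 \<Longrightarrow> j \<ge> 1 \<Longrightarrow> variance (a i j) = \<sigma> i * \<sigma> j"
    and averages: "\<And>k. k \<ge> 1 \<Longrightarrow> (\<lambda>n. (\<Sum>i=1..n. \<sigma> i ^ k) / real n) \<longlonglongrightarrow> \<Lambda> k"
begin

section \<open>Expectations of products of entries along walks\<close>

definition entry :: "nat \<times> nat \<Rightarrow> 'w \<Rightarrow> real" where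
  "entry = (\<lambda>(i, j). a i j)"

text \<open>Exactly the sorted pairs that \<open>edge\<close> produces from positive vertices; over
  these the entries are independent.\<close>

definition idx :: "(nat \<times> nat) set" where
  "idx = {(i, j). 1 \<le> i \<and> i \<le> j}"

definition path_prod :: "(nat \<times> nat) list \<Rightarrow> 'w \<Rightarrow> real" where
  "path_prod L \<omega> = (\<Prod>e\<leftarrow>L. entry e \<omega>)"

lemma entry_measurable [measurable]: "e \<in> idx \<Longrightarrow> entry e \<in> borel_measurable M"
  using indep unfolding indep_vars_def2 entry_def idx_def by blast

lemma entry_bounded:
  assumes "e \<in> idx"
  shows "AE \<omega> in M. \<bar>entry e \<omega>\<bar> \<le> K"
proof -
  obtain i j where e: "e = (i, j)" "1 \<le> i" "i \<le> j" using assms by (auto simp: idx_def)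
  have m: "a i j \<in> borel_measurable M" using entry_measurable[OF assms] by (simp add: entry_def e)
  have "AE \<omega> in M. \<bar>a i j \<omega>\<bar> < K"
    using bounded[of i j] e m prob_Collect_eq_1[of "\<lambda>\<omega>. \<bar>a i j \<omega>\<bar> < K"] by simp
  then show ?thesis by eventually_elim (simp add: entry_def e)
qed

lemma entry_power_integrable:
  assumes "e \<in> idx"
  shows "integrable M (\<lambda>\<omega>. entry e \<omega> ^ c)"
proof (rule integrable_const_bound[of _ "K ^ c"])
  show "AE \<omega> in M. norm (entry e \<omega> ^ c) \<le> K ^ c"
    using entry_bounded[OF assms] by eventually_elim (auto simp: power_abs intro!: power_mono)
qed (use assms in measurable)

lemma entry_power_expectation:
  assumes "e \<in> idx"
  shows "\<bar>expectation (\<lambda>\<omega>. entry e \<omega> ^ c)\<bar> \<le> K ^ c"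
proof (rule abs_expectation_le)
  show "AE \<omega> in M. \<bar>entry e \<omega> ^ c\<bar> \<le> K ^ c"
    using entry_bounded[OF assms] by eventually_elim (auto simp: power_abs intro!: power_mono)
qed (rule entry_power_integrable[OF assms])

lemma entry_mean:
  assumes "e \<in> idx"
  shows "expectation (entry e) = 0"
proof -
  obtain i j where e: "e = (i, j)" by (cases e)
  have "i \<ge> 1" "j \<ge> 1" using assms by (auto simp: idx_def e)
  then have "expectation (a i j) = 0" by (rule mean)
  then show ?thesis unfolding entry_def e prod.case .
qed

lemma entry_variance:
  assumes "(i, j) \<in> idx"
  shows "expectation (\<lambda>\<omega>. (entry (i, j) \<omega>)\<^sup>2) = \<sigma> i * \<sigma> j"
proof -
  have ij: "i \<ge> 1" "j \<ge> 1" using assms by (auto simp: idx_def)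
  show ?thesis using variance[OF ij] unfolding mean[OF ij] by (simp add: entry_def)
qed

lemma \<sigma>_le: "i \<ge> 1 \<Longrightarrow> \<sigma> i \<le> K"
proof -
  assume i: "i \<ge> 1"
  then have e: "(i, i) \<in> idx" by (simp add: idx_def)
  have "(\<sigma> i)\<^sup>2 \<le> K\<^sup>2"
    using entry_power_expectation[OF e, of 2]
    unfolding entry_variance[OF e] power2_eq_square[symmetric] by (rule abs_le_D1)
  then show ?thesis by (rule power2_le_imp_le) (use K_pos in simp)
qed

sublocale bounded_profile \<sigma> \<Lambda> K
proof
  show "\<sigma> i \<ge> 0" if "i \<ge> 1" for i using \<sigma>_pos[OF that] by simp
  show "\<sigma> i \<le> K" if "i \<ge> 1" for i using that by (rule \<sigma>_le)
  show "(\<lambda>n. (\<Sum>i=1..n. \<sigma> i ^ k) / real n) \<longlonglongrightarrow> \<Lambda> k" if "k \<ge> 1" for k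
    using that by (rule averages)
qed

lemma path_prod_eq: "path_prod L = (\<lambda>\<omega>. \<Prod>e\<in>set L. entry e \<omega> ^ count_list L e)"
  by (rule ext) (simp add: path_prod_def prod_list_count)

lemma path_prod_append: "path_prod (L @ L') \<omega> = path_prod L \<omega> * path_prod L' \<omega>"
  by (simp add: path_prod_def)

text \<open>Independence concerns distinct entries, so repeated ones are first collected into
  powers.\<close>

lemma path_prod_integrable: "set L \<subseteq> idx \<Longrightarrow> integrable M (path_prod L)"
  and path_prod_expectation: "set L \<subseteq> idx \<Longrightarrow>
    expectation (path_prod L) = (\<Prod>e\<in>set L. expectation (\<lambda>\<omega>. entry e \<omega> ^ count_list L e))"
proof -
  assume L: "set L \<subseteq> idx"
  have "indep_vars (\<lambda>_. borel) entry (set L)"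
    using indep L unfolding entry_def idx_def by (rule indep_vars_subset)
  then have ind: "indep_vars (\<lambda>_. borel) (\<lambda>e \<omega>. entry e \<omega> ^ count_list L e) (set L)"
    by (rule indep_vars_compose2) auto
  have int: "integrable M (\<lambda>\<omega>. entry e \<omega> ^ count_list L e)" if "e \<in> set L" for e
    using L that by (intro entry_power_integrable) auto
  show "integrable M (path_prod L)"
    unfolding path_prod_eq using ind int by (intro indep_vars_integrable) auto
  show "expectation (path_prod L) = (\<Prod>e\<in>set L. expectation (\<lambda>\<omega>. entry e \<omega> ^ count_list L e))"
    unfolding path_prod_eq using ind int by (intro indep_vars_lebesgue_integral) auto
qed

lemma path_prod_expectation_bound:
  assumes L: "set L \<subseteq> idx"
  shows "\<bar>expectation (path_prod L)\<bar> \<le> K ^ length L"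
proof -
  have "\<bar>expectation (path_prod L)\<bar> \<le> (\<Prod>e\<in>set L. K ^ count_list L e)"
    unfolding path_prod_expectation[OF L] abs_prod
    using L by (intro prod_mono) (auto intro!: entry_power_expectation)
  also have "\<dots> = K ^ length L" by (simp add: sum_count_set flip: power_sum)
  finally show ?thesis .
qed

lemma path_prod_expectation_light:
  assumes L: "set L \<subseteq> idx" and "\<not> heavy L"
  shows "expectation (path_prod L) = 0"
proof -
  obtain e where e: "e \<in> set L" "count_list L e < 2"
    using assms(2) by (auto simp: heavy_def not_le)
  moreover have "count_list L e \<noteq> 0" using e by (simp add: count_list_0_iff)
  ultimately have "count_list L e = 1" by linarith
  then have "expectation (\<lambda>\<omega>. entry e \<omega> ^ count_list L e) = 0"
    using entry_mean[of e] e L by auto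
  then show ?thesis unfolding path_prod_expectation[OF L] using e by (intro prod_zero) auto
qed

lemma path_prod_expectation_disjoint:
  assumes L: "set L \<subseteq> idx" "set L' \<subseteq> idx" and d: "set L \<inter> set L' = {}"
  shows "expectation (path_prod (L @ L')) = expectation (path_prod L) * expectation (path_prod L')"
proof -
  have LL: "set (L @ L') \<subseteq> idx" using L by simp
  let ?E = "\<lambda>L e. expectation (\<lambda>\<omega>. entry e \<omega> ^ count_list L e)"
  have "expectation (path_prod (L @ L')) = (\<Prod>e\<in>set L. ?E (L @ L') e) * (\<Prod>e\<in>set L'. ?E (L @ L') e)"
    unfolding path_prod_expectation[OF LL] set_append using d by (intro prod.union_disjoint) auto
  also have "(\<Prod>e\<in>set L. ?E (L @ L') e) = (\<Prod>e\<in>set L. ?E L e)"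
    using d by (intro prod.cong refl) (auto simp: count_notin disjoint_iff)
  also have "(\<Prod>e\<in>set L'. ?E (L @ L') e) = (\<Prod>e\<in>set L'. ?E L' e)"
  proof (rule prod.cong[OF refl])
    fix e assume "e \<in> set L'"
    then have "e \<notin> set L" using d by auto
    then show "?E (L @ L') e = ?E L' e" by (simp add: count_notin)
  qed
  finally show ?thesis using L by (simp add: path_prod_expectation)
qed

lemma closed_walks_idx: "w \<in> closed_walks n k \<Longrightarrow> set (wedges w) \<subseteq> idx"
proof clarify
  fix i j assume w: "w \<in> closed_walks n k" and ij: "(i, j) \<in> set (wedges w)"
  have "(i, j) \<in> set w \<times> set w" using wedges_subset[of w] ij by blast
  moreover have "set w \<subseteq> {1..n}" using w by (simp add: closed_walks_def)
  ultimately show "(i, j) \<in> idx" using wedges_ordered[OF ij] by (auto simp: idx_def)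
qed

lemma path_prod_expectation_good:
  assumes w: "w \<in> good_walks n s"
  shows "expectation (path_prod (wedges w)) = weight \<sigma> w"
proof -
  have idx: "set (wedges w) \<subseteq> idx" using w closed_walks_idx by (auto simp: good_walks_def)
  note W = good_walksD[OF w]
  \<comment> \<open>Having s + 1 vertices forces s distinct edges among 2 s steps, the equality case
    of \<open>heavy_card\<close>.\<close>
  have "count_list (wedges w) e = 2" if "e \<in> set (wedges w)" for e
    using W card_set_le_wedges[OF W(5)] that
    by (intro heavy_card_eq) (auto simp: good_def length_wedges)
  then show ?thesis
    unfolding path_prod_expectation[OF idx] weight_def
    using idx entry_variance by (intro prod.cong) (auto split: prod.splits)
qed

text \<open>The trace of the k-th power of the unscaled matrix; the scaling reappears as the divisor
  \<open>real n * sqrt (real n) ^ k\<close>.\<close>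

definition trace_walks :: "nat \<Rightarrow> nat \<Rightarrow> 'w \<Rightarrow> real" where
  "trace_walks n k \<omega> = (\<Sum>w\<in>closed_walks n k. path_prod (wedges w) \<omega>)"

lemma trace_walks_eq: "trace_walks n k = (\<lambda>\<omega>. \<Sum>w\<in>closed_walks n k. path_prod (wedges w) \<omega>)"
  by (rule ext) (rule trace_walks_def)

lemma trace_walks_integrable: "integrable M (trace_walks n k)"
  unfolding trace_walks_eq
  by (intro Bochner_Integration.integrable_sum path_prod_integrable closed_walks_idx) assumption

lemma trace_walks_expectation:
  "expectation (trace_walks n k) = (\<Sum>w\<in>closed_walks n k. expectation (path_prod (wedges w)))"
  unfolding trace_walks_eq
  by (subst Bochner_Integration.integral_sum)
     (intro path_prod_integrable closed_walks_idx, assumption, rule refl)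

text \<open>Heavy walks that are not good miss the maximal number (k + 2) / 2 of vertices, so at
  most (k + 1) div 2 remain. Against n^(1 + k/2) the error is of order n^(-1/2). Good walks exist
  for even k only.\<close>

lemma trace_walks_expectation_bound:
  assumes n: "n > 0"
  shows "\<bar>expectation (trace_walks n k) - (if even k then good_sum \<sigma> n (k div 2) 0 else 0)\<bar>
    \<le> K ^ k * real (((k + 1) div 2) ^ (k + 1)) * real n ^ ((k + 1) div 2)"
proof -
  let ?v = "(k + 1) div 2"
  let ?E = "\<lambda>w. expectation (path_prod (wedges w))"
  let ?good = "{w \<in> closed_walks n k. good w}" and ?bad = "{w \<in> closed_walks n k. \<not> good w}"
  let ?few = "{w. set w \<subseteq> {1..n} \<and> length w = k + 1 \<and> card (set w) \<le> ?v}"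
  have fin: "finite ?few"
    by (rule finite_subset[OF _ finite_lists_length_eq[of "{1..n}" "k + 1"]]) auto
  have good: "(\<Sum>w\<in>?good. ?E w) = (if even k then good_sum \<sigma> n (k div 2) 0 else 0)"
  proof (cases "even k")
    case True
    then have "?good = good_walks n (k div 2)" by (simp add: good_walks_def)
    with True show ?thesis by (simp add: good_sum_def path_prod_expectation_good)
  next
    case False
    then have "?good = {}" by (auto simp: closed_walks_def dest: good_odd_length)
    then show ?thesis using False by (simp only: sum.empty if_False)
  qed
  have bad: "\<bar>?E w\<bar> \<le> (if w \<in> ?few then K ^ k else 0)" if w: "w \<in> ?bad" for w
  proof -
    have idx: "set (wedges w) \<subseteq> idx" using w closed_walks_idx by auto
    have w': "w \<noteq> []" "hd w = last w" "length w = k + 1" "set w \<subseteq> {1..n}" "\<not> good w"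
      using w by (auto simp: closed_walks_def)
    show ?thesis
    proof (cases "heavy (wedges w)")
      case False
      then show ?thesis using path_prod_expectation_light[OF idx] K_pos by simp
    next
      case True
      \<comment> \<open>Since \<open>length w = k + 1\<close>, the bound is k + 2, and attaining it
        would make w good.\<close>
      then have "2 * card (set w) \<le> k + 1"
        using w' heavy_walk_card[OF w'(1) True] by (auto simp: good_def)
      then have "w \<in> ?few" using w' by auto
      moreover have "\<bar>?E w\<bar> \<le> K ^ k"
        using path_prod_expectation_bound[OF idx] w' by (simp add: length_wedges)
      ultimately show ?thesis by simp
    qed
  qed
  have "expectation (trace_walks n k) = (\<Sum>w\<in>?good \<union> ?bad. ?E w)"
    unfolding trace_walks_expectation by (intro sum.cong) auto
  also have "\<dots> = (\<Sum>w\<in>?good. ?E w) + (\<Sum>w\<in>?bad. ?E w)"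
    using finite_closed_walks by (intro sum.union_disjoint) auto
  finally have "\<bar>expectation (trace_walks n k) - (if even k then good_sum \<sigma> n (k div 2) 0 else 0)\<bar>
      = \<bar>\<Sum>w\<in>?bad. ?E w\<bar>" by (simp add: good)
  also have "\<dots> \<le> (\<Sum>w\<in>?bad. if w \<in> ?few then K ^ k else 0)"
    using bad by (intro order_trans[OF sum_abs] sum_mono)
  also have "\<dots> = (\<Sum>w\<in>?bad \<inter> ?few. K ^ k)"
    by (intro sum.inter_restrict[symmetric]) (use finite_closed_walks in simp)
  also have "\<dots> \<le> real (card ?few) * K ^ k"
    using card_mono[OF fin, of "?bad \<inter> ?few"] K_pos by (simp add: mult_right_mono)
  also have "\<dots> \<le> real (?v ^ (k + 1) * n ^ ?v) * K ^ k"
    using card_lists_few_values[OF n, of "k + 1" ?v] K_pos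
    by (intro mult_right_mono) (simp only: of_nat_le_iff, simp)
  finally show ?thesis by (simp add: mult_ac)
qed

lemma trace_walks_expectation_tendsto:
  "(\<lambda>n. expectation (trace_walks n k) / (real n * sqrt (real n) ^ k)) \<longlonglongrightarrow>
    (if even k then tree_moment \<Lambda> (k div 2) 0 else 0)"
proof -
  let ?G = "\<lambda>n. if even k then good_sum \<sigma> n (k div 2) 0 else 0"
  define c where "c = K ^ k * real (((k + 1) div 2) ^ (k + 1))"
  have c: "c \<ge> 0" using K_pos by (simp add: c_def)
  have G: "(\<lambda>n. ?G n / (real n * sqrt (real n) ^ k)) \<longlonglongrightarrow>
      (if even k then tree_moment \<Lambda> (k div 2) 0 else 0)"
  proof (cases "even k")
    case True
    then obtain s where "k = 2 * s" by blast
    then show ?thesis using good_sum_tendsto[of s 0] by (simp add: power_mult)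
  qed simp
  have "(\<lambda>n. (expectation (trace_walks n k) - ?G n) / (real n * sqrt (real n) ^ k)) \<longlonglongrightarrow> 0"
  proof (rule Lim_null_comparison)
    show "\<forall>\<^sub>F n in sequentially. norm ((expectation (trace_walks n k) - ?G n) / (real n * sqrt (real n) ^ k))
        \<le> c / sqrt (real n)"
      using eventually_gt_at_top[of 0]
    proof eventually_elim
      case (elim n)
      let ?r = "sqrt (real n)"
      have r: "?r \<ge> 1" using elim by simp
      have "real n ^ ((k + 1) div 2) = ?r ^ (2 * ((k + 1) div 2))" by (simp add: power_mult)
      also have "\<dots> \<le> ?r ^ (k + 1)" using r by (intro power_increasing) auto
      finally have "c * real n ^ ((k + 1) div 2) \<le> c * ?r ^ (k + 1)" using c by (rule mult_left_mono)
      with trace_walks_expectation_bound[OF elim, of k]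
      have "\<bar>expectation (trace_walks n k) - ?G n\<bar> \<le> c * ?r ^ (k + 1)" unfolding c_def by linarith
      then have "\<bar>expectation (trace_walks n k) - ?G n\<bar> / (real n * ?r ^ k) \<le>
          c * ?r ^ (k + 1) / (real n * ?r ^ k)"
        by (intro divide_right_mono) auto
      also have "\<dots> = c * ?r / real n" using r by (simp add: field_simps)
      also have "\<dots> = c / ?r" using elim by (simp add: field_simps)
      finally show ?case by (simp add: abs_mult)
    qed
    have "filterlim (\<lambda>n. sqrt (real n)) at_top sequentially"
      by (rule filterlim_compose[OF sqrt_at_top filterlim_real_sequentially])
    then show "(\<lambda>n. c / sqrt (real n)) \<longlonglongrightarrow> 0"
      by (intro tendsto_divide_0[OF tendsto_const] filterlim_at_top_imp_at_infinity)
  qed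
  from tendsto_add[OF this G] show ?thesis by (simp add: diff_divide_distrib)
qed

section \<open>Variance of the unscaled trace\<close>

lemma trace_walks_square:
  "(trace_walks n k \<omega>)\<^sup>2 = (\<Sum>w\<in>closed_walks n k. \<Sum>w'\<in>closed_walks n k. path_prod (wedges w @ wedges w') \<omega>)"
  by (simp add: trace_walks_def power2_eq_square sum_product path_prod_append)

lemma trace_walks_square_integrable: "integrable M (\<lambda>\<omega>. (trace_walks n k \<omega>)\<^sup>2)"
  unfolding trace_walks_square
proof (intro Bochner_Integration.integrable_sum path_prod_integrable)
  fix w w' assume "w \<in> closed_walks n k" "w' \<in> closed_walks n k"
  then show "set (wedges w @ wedges w') \<subseteq> idx"
    using closed_walks_idx[of w n k] closed_walks_idx[of w' n k] by simp
qed

text \<open>The covariance of two walks vanishes if they share no edge, by independence, and if some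
  edge is used once in total. The remaining pairs have at most k vertices by
  \<open>card_pair_walks_le\<close>.\<close>

lemma trace_walks_variance:
  assumes n: "n > 0"
  shows "prob_space.variance M (trace_walks n k) \<le> 2 * K ^ (2 * k) * real (k ^ (2 * k + 2)) * real n ^ k"
proof -
  let ?W = "closed_walks n k"
  let ?E = "\<lambda>L. expectation (path_prod L)"
  let ?few = "{u. set u \<subseteq> {1..n} \<and> length u = 2 * k + 2 \<and> card (set u) \<le> k}"
  let ?P = "{(w, w') \<in> ?W \<times> ?W. card (set w \<union> set w') \<le> k}"
  have fin: "finite ?few"
    by (rule finite_subset[OF _ finite_lists_length_eq[of "{1..n}" "2 * k + 2"]]) auto
  have W: "length w = k + 1" "set w \<subseteq> {1..n}" if "w \<in> ?W" for w
    using that by (simp_all add: closed_walks_def)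
  have finW: "finite (?W \<times> ?W)" using finite_closed_walks by simp
  have E2: "expectation (\<lambda>\<omega>. (trace_walks n k \<omega>)\<^sup>2) = (\<Sum>(w, w')\<in>?W \<times> ?W. ?E (wedges w @ wedges w'))"
    unfolding trace_walks_square sum.cartesian_product
  proof (subst Bochner_Integration.integral_sum)
    fix x assume "x \<in> ?W \<times> ?W"
    then obtain w w' where x: "x = (w, w')" "w \<in> ?W" "w' \<in> ?W" by auto
    then have "set (wedges w @ wedges w') \<subseteq> idx" using closed_walks_idx[of w] closed_walks_idx[of w'] by simp
    from path_prod_integrable[OF this]
    show "integrable M (\<lambda>\<omega>. case x of (w, w') \<Rightarrow> path_prod (wedges w @ wedges w') \<omega>)" by (simp add: x)
  qed (simp add: case_prod_unfold)
  have "prob_space.variance M (trace_walks n k) =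
      expectation (\<lambda>\<omega>. (trace_walks n k \<omega>)\<^sup>2) - (expectation (trace_walks n k))\<^sup>2"
    by (rule variance_eq[OF trace_walks_integrable trace_walks_square_integrable])
  also have "\<dots> = (\<Sum>(w, w')\<in>?W \<times> ?W. ?E (wedges w @ wedges w') - ?E (wedges w) * ?E (wedges w'))"
    unfolding E2
    unfolding trace_walks_expectation power2_eq_square sum_product sum.cartesian_product
    by (simp add: case_prod_unfold sum_subtractf)
  also have "\<dots> \<le> (\<Sum>x\<in>?W \<times> ?W. if x \<in> ?P then 2 * K ^ (2 * k) else 0)"
  proof (rule sum_mono, clarify)
    fix w w' assume w: "w \<in> ?W" "w' \<in> ?W"
    let ?c = "?E (wedges w @ wedges w') - ?E (wedges w) * ?E (wedges w')"
    have idx: "set (wedges w) \<subseteq> idx" "set (wedges w') \<subseteq> idx" "set (wedges w @ wedges w') \<subseteq> idx"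
      using closed_walks_idx[OF w(1)] closed_walks_idx[OF w(2)] by simp_all
    have w': "w \<noteq> []" "hd w = last w" "length w = k + 1" "w' \<noteq> []" "hd w' = last w'" "length w' = k + 1"
      using w by (auto simp: closed_walks_def)
    show "?c \<le> (if (w, w') \<in> ?P then 2 * K ^ (2 * k) else 0)"
    proof (cases "set (wedges w) \<inter> set (wedges w') = {}")
      case True
      then show ?thesis using path_prod_expectation_disjoint[OF idx(1,2)] K_pos by simp
    next
      case sh: False
      show ?thesis
      proof (cases "heavy (wedges w @ wedges w')")
        case True
        have "(w, w') \<in> ?P" using card_pair_walks_le[OF w' True sh] w by simp
        moreover have "\<bar>?E (wedges w @ wedges w')\<bar> \<le> K ^ (2 * k)"
          using path_prod_expectation_bound[OF idx(3)] w' by (simp add: length_wedges mult_2)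
        moreover have "\<bar>?E (wedges w) * ?E (wedges w')\<bar> \<le> K ^ k * K ^ k"
          unfolding abs_mult
          using path_prod_expectation_bound[OF idx(1)] path_prod_expectation_bound[OF idx(2)] w' K_pos
          by (intro mult_mono) (auto simp: length_wedges)
        moreover have "K ^ k * K ^ k = K ^ (2 * k)" by (simp add: mult_2 power_add)
        ultimately show ?thesis by simp
      next
        case False
        then obtain e where e: "e \<in> set (wedges w @ wedges w')" "count_list (wedges w @ wedges w') e < 2"
          by (auto simp: heavy_def not_le simp del: set_append)
        \<comment> \<open>An edge used once in total makes one of the two walks use it exactly once,
          so the product of the two means vanishes as well.\<close>
        have "count_list (wedges w) e < 2" "count_list (wedges w') e < 2" using e(2) by auto
        then have "\<not> heavy (wedges w) \<or> \<not> heavy (wedges w')"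
          using e(1) unfolding heavy_def set_append by (meson UnE not_le)
        then have "?E (wedges w) * ?E (wedges w') = 0"
          using path_prod_expectation_light idx by auto
        moreover have "?E (wedges w @ wedges w') = 0"
          using False path_prod_expectation_light[OF idx(3)] by simp
        ultimately have "?c = 0" by (simp only: diff_self)
        then show ?thesis using K_pos by simp
      qed
    qed
  qed
  also have "\<dots> = real (card ?P) * (2 * K ^ (2 * k))"
  proof -
    have "(?W \<times> ?W) \<inter> ?P = ?P" by blast
    then show ?thesis by (simp only: sum.inter_restrict[OF finW, symmetric] sum_constant)
  qed
  also have "\<dots> \<le> real (k ^ (2 * k + 2) * n ^ k) * (2 * K ^ (2 * k))"
  proof (rule mult_right_mono)
    have "card ?P = card ((\<lambda>(w, w'). w @ w') ` ?P)"
      by (intro card_image[symmetric] inj_onI) (auto simp: W)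
    also have "\<dots> \<le> card ?few"
    proof (rule card_mono[OF fin], clarify)
      fix w w' assume w: "w \<in> ?W" "w' \<in> ?W" "card (set w \<union> set w') \<le> k"
      then show "set (w @ w') \<subseteq> {1..n} \<and> length (w @ w') = 2 * k + 2 \<and> card (set (w @ w')) \<le> k"
        using W(2)[OF w(1)] W(2)[OF w(2)] by (simp add: W(1))
    qed
    also have "\<dots> \<le> k ^ (2 * k + 2) * n ^ k" by (rule card_lists_few_values[OF n])
    finally show "real (card ?P) \<le> real (k ^ (2 * k + 2) * n ^ k)" by (simp only: of_nat_le_iff)
  qed (use K_pos in simp)
  finally show ?thesis by (simp only: of_nat_mult of_nat_power mult_ac)
qed

section \<open>Moments of the empirical spectral distribution\<close>

lemma entry_edge:
  assumes "x \<ge> 1" "y \<ge> 1" "\<omega> \<in> space M"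
  shows "entry (edge x y) \<omega> = a x y \<omega>"
proof (cases "x \<le> y")
  case False
  then have "entry (edge x y) \<omega> = a y x \<omega>" by (simp add: entry_def edge_def)
  with symmetric[OF assms] show ?thesis by simp
qed (simp add: entry_def edge_def)

lemma scaled_matrix_carrier: "scaled_matrix a n \<omega> \<in> carrier_mat n n"
  by (simp add: scaled_matrix_def)

lemma scaled_matrix_symmetric:
  assumes "\<omega> \<in> space M"
  shows "transpose_mat (scaled_matrix a n \<omega>) = scaled_matrix a n \<omega>"
proof (rule eq_matI)
  fix i j assume "i < dim_row (scaled_matrix a n \<omega>)" "j < dim_col (scaled_matrix a n \<omega>)"
  then show "transpose_mat (scaled_matrix a n \<omega>) $$ (i, j) = scaled_matrix a n \<omega> $$ (i, j)"
    using symmetric[of "Suc i" "Suc j" \<omega>] assms by (simp add: scaled_matrix_def)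
qed (simp_all add: scaled_matrix_def)

lemma esd_moment:
  assumes \<omega>: "\<omega> \<in> space M" and n: "n > 0"
  shows "(LINT x|interval_measure (esd (scaled_matrix a n \<omega>)). x ^ k) =
    trace_walks n k \<omega> / (real n * sqrt (real n) ^ k)"
proof -
  let ?A = "scaled_matrix a n \<omega>"
  let ?c = "\<lambda>e. entry e \<omega> / sqrt (real n)"
  note A = scaled_matrix_carrier[of n \<omega>] scaled_matrix_symmetric[OF \<omega>, of n]
  have "?A = Matrix.mat n n (\<lambda>(i, j). ?c (edge (Suc i) (Suc j)))"
    unfolding scaled_matrix_def using \<omega> by (intro cong_mat) (auto simp: entry_edge)
  then have "mat_trace (?A ^\<^sub>m k) = (\<Sum>w\<in>closed_walks n k. \<Prod>e\<leftarrow>wedges w. ?c e)"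
    by (simp only: mat_trace_pow_walks[of n ?c k])
  also have "\<dots> = (\<Sum>w\<in>closed_walks n k. path_prod (wedges w) \<omega> / sqrt (real n) ^ k)"
  proof (rule sum.cong[OF refl])
    fix w assume "w \<in> closed_walks n k"
    then have "length (wedges w) = k" by (simp add: closed_walks_def length_wedges)
    moreover have "(\<Prod>e\<leftarrow>L. ?c e) = path_prod L \<omega> / sqrt (real n) ^ length L" for L
      unfolding path_prod_def by (induction L) auto
    ultimately show "(\<Prod>e\<leftarrow>wedges w. ?c e) = path_prod (wedges w) \<omega> / sqrt (real n) ^ k" by simp
  qed
  also have "\<dots> = trace_walks n k \<omega> / sqrt (real n) ^ k"
    by (simp add: trace_walks_def sum_divide_distrib)
  finally have "(\<Sum>e\<leftarrow>eigenvalues ?A. e ^ k) = trace_walks n k \<omega> / sqrt (real n) ^ k"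
    by (simp add: mat_trace_pow_symmetric[OF A])
  then show ?thesis by (simp add: esd_integral(2)[OF A n])
qed

text \<open>The shift to \<open>Suc n\<close> avoids the empty matrix, whose \<open>esd\<close> is
  no distribution function. The squared divisor is (n + 1)^(k+2), against a variance of order (n +
  1)^k.\<close>

lemma AE_esd_moments:
  "AE \<omega> in M. \<forall>k. (\<lambda>n. LINT x|interval_measure (esd (scaled_matrix a (Suc n) \<omega>)). x ^ k) \<longlonglongrightarrow>
    (if even k then tree_moment \<Lambda> (k div 2) 0 else 0)"
proof -
  have "AE \<omega> in M. (\<lambda>n. trace_walks (Suc n) k \<omega> / (real (Suc n) * sqrt (real (Suc n)) ^ k)) \<longlonglongrightarrow>
      (if even k then tree_moment \<Lambda> (k div 2) 0 else 0)" for k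
  proof (rule AE_tendsto_of_variance)
    fix n
    let ?N = "real (Suc n) * sqrt (real (Suc n)) ^ k"
    let ?C = "2 * K ^ (2 * k) * real (k ^ (2 * k + 2))"
    have N2: "?N\<^sup>2 = real (Suc n) ^ 2 * real (Suc n) ^ k"
      by (simp add: power_mult_distrib real_sqrt_power_even flip: power_mult mult.commute)
    show "random_variable borel (\<lambda>\<omega>. trace_walks (Suc n) k \<omega> / ?N)"
      using borel_measurable_integrable[OF trace_walks_integrable] by measurable
    show "integrable M (\<lambda>\<omega>. (trace_walks (Suc n) k \<omega> / ?N)\<^sup>2)"
      unfolding power_divide by (intro integrable_divide trace_walks_square_integrable)
    have "prob_space.variance M (\<lambda>\<omega>. trace_walks (Suc n) k \<omega> / ?N) =
        prob_space.variance M (trace_walks (Suc n) k) / ?N\<^sup>2"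
      by (simp add: power_divide flip: diff_divide_distrib)
    also have "\<dots> \<le> (?C * real (Suc n) ^ k) / ?N\<^sup>2"
      by (intro divide_right_mono trace_walks_variance) auto
    also have "\<dots> = ?C / real (Suc n) ^ 2" unfolding N2 by (simp add: field_simps)
    finally show "prob_space.variance M (\<lambda>\<omega>. trace_walks (Suc n) k \<omega> / ?N) \<le> ?C / real (Suc n) ^ 2" .
  next
    show "(\<lambda>n. expectation (\<lambda>\<omega>. trace_walks (Suc n) k \<omega> / (real (Suc n) * sqrt (real (Suc n)) ^ k)))
        \<longlonglongrightarrow> (if even k then tree_moment \<Lambda> (k div 2) 0 else 0)"
      using LIMSEQ_Suc[OF trace_walks_expectation_tendsto[of k]] by simp
  qed
  then have "AE \<omega> in M. \<forall>k. (\<lambda>n. trace_walks (Suc n) k \<omega> / (real (Suc n) * sqrt (real (Suc n)) ^ k)) \<longlonglongrightarrow>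
      (if even k then tree_moment \<Lambda> (k div 2) 0 else 0)"
    by (simp only: AE_all_countable simp_thms)
  then show ?thesis
    using AE_space
  proof eventually_elim
    case (elim \<omega>)
    then show ?case by (simp only: esd_moment zero_less_Suc simp_thms)
  qed
qed

text \<open>The closed form involves L at positive arguments only, so the special value at 0 drops
  out.\<close>

lemma tree_moment_eq_even_moment:
  assumes "s \<ge> 1"
  shows "tree_moment \<Lambda> s 0 = even_moment \<Lambda> s"
proof -
  have "tree_moment \<Lambda> s 0 = 2 / (real s + 1) *
      fps_nth (Abs_fps (\<lambda>j. if Suc j = 0 then 1 else \<Lambda> (Suc j)) ^ (s + 1)) (s - 1)"
    by (rule tree_recursion_closed_form[OF _ _ assms]) auto
  then show ?thesis using even_moment_eq_coeff[OF assms] by simp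
qed

end

section \<open>The limit law\<close>

lemma interval_measure_cdf:
  assumes "real_distribution \<mu>"
  shows "distribution_function (cdf \<mu>)" "interval_measure (cdf \<mu>) = \<mu>"
proof -
  interpret real_distribution \<mu> by (rule assms)
  show F: "distribution_function (cdf \<mu>)"
    unfolding distribution_function_def
    by (auto intro!: monoI cdf_nondecreasing cdf_is_right_cont cdf_lim_at_bot cdf_lim_at_top_prob)
  show "interval_measure (cdf \<mu>) = \<mu>"
    by (intro cdf_unique assms distribution_function_real_distribution F)
qed

text \<open>A continuous step falling from 1 at x to 0 at y > x lies between the two indicators, so
  F x \<le> G y; right continuity of G lets y tend to x.\<close>

lemma distribution_function_le:
  assumes F: "distribution_function F" and G: "distribution_function G"
    and eq: "\<And>f :: real \<Rightarrow> real. continuous_on UNIV f \<Longrightarrow> bounded (range f) \<Longrightarrow>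
      (LINT x|interval_measure F. f x) = (LINT x|interval_measure G. f x)"
  shows "F x \<le> G x"
proof -
  interpret F: real_distribution "interval_measure F"
    by (rule distribution_function_real_distribution[OF F])
  interpret G: real_distribution "interval_measure G"
    by (rule distribution_function_real_distribution[OF G])
  have cdf: "cdf (interval_measure F) = F" "cdf (interval_measure G) = G"
    using F G distribution_function_real_distribution by auto
  have "F x \<le> G y" if "x < y" for y
  proof -
    have "F x \<le> (LINT u|interval_measure F. cts_step x y u)"
      using F.cdf_cts_step[OF that] by (simp add: cdf)
    also have "\<dots> = (LINT u|interval_measure G. cts_step x y u)"
    proof (rule eq)
      show "continuous_on UNIV (cts_step x y)"
        by (intro uniformly_continuous_imp_continuous cts_step_uniformly_continuous that)
      show "bounded (range (cts_step x y))"
        using that by (intro boundedI[of _ 1]) (auto simp: cts_step_def)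
    qed
    also have "\<dots> \<le> G y" using G.cdf_cts_step[OF that] by (simp add: cdf)
    finally show ?thesis .
  qed
  then have "\<forall>\<^sub>F y in at_right x. F x \<le> G y"
    using eventually_at_right_less[of x] by (auto elim: eventually_mono)
  moreover have "(G \<longlongrightarrow> G x) (at_right x)"
    using G by (simp add: distribution_function_def continuous_within)
  ultimately show ?thesis by (intro tendsto_lowerbound) auto
qed

lemma (in bounded_wigner) semicircle_type_law:
  "\<exists>F. distribution_function F \<and> has_limit_moments \<Lambda> F \<and>
    (\<forall>G. distribution_function G \<and> has_limit_moments \<Lambda> G \<longrightarrow> G = F) \<and>
    (\<forall>f :: real \<Rightarrow> real. continuous_on UNIV f \<and> bounded (range f) \<longrightarrow>
      (AE \<omega> in M. (\<lambda>n. LINT x|interval_measure (esd (scaled_matrix a n \<omega>)). f x)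
                    \<longlonglongrightarrow> (LINT x|interval_measure F. f x))) \<and>
    (\<exists>S\<in>sets M. prob S = 1 \<and> (\<forall>\<omega>\<in>S. weakly_converges (\<lambda>n. esd (scaled_matrix a n \<omega>)) F))"
proof -
  define m where "m k = (if even k then tree_moment \<Lambda> (k div 2) 0 else 0)" for k
  let ?\<nu> = "\<lambda>\<omega> n. interval_measure (esd (scaled_matrix a (Suc n) \<omega>))"
  have m_even: "m (2 * s) = even_moment \<Lambda> s" if "s \<ge> 1" for s
    using tree_moment_eq_even_moment[OF that] by (simp add: m_def)
  have m_odd: "m (2 * s + 1) = 0" and m_0: "m 0 = 1" for s by (simp_all add: m_def)
  have m_bound: "m (2 * s) \<le> (2 * K) ^ (2 * s)" if "s \<ge> 1" for s
    using even_moment_bound[OF \<Lambda>_bound that K_nonneg] m_even[OF that] by simp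
  have C: "2 * K \<ge> 0" using K_nonneg by simp
  obtain S where S: "S \<in> events" "prob S = 1"
    and S_lim: "\<And>\<omega> k. \<omega> \<in> S \<Longrightarrow> (\<lambda>n. LINT x|?\<nu> \<omega> n. x ^ k) \<longlonglongrightarrow> m k"
  proof -
    from AE_esd_moments obtain N where N: "N \<in> null_sets M"
      "{\<omega> \<in> space M. \<not> (\<forall>k. (\<lambda>n. LINT x|?\<nu> \<omega> n. x ^ k) \<longlonglongrightarrow> m k)} \<subseteq> N"
      unfolding m_def eventually_ae_filter by blast
    have "prob (space M - N) = 1"
      using prob_compl[of N] N(1) by (simp add: null_sets_def measure_def)
    then show thesis using N by (intro that[of "space M - N"]) auto
  qed
  have S_sub: "\<omega> \<in> space M" if "\<omega> \<in> S" for \<omega> using S(1) that sets.sets_into_space by blast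
  have cm: "convergent_moments (?\<nu> \<omega>) m (2 * K)" if \<omega>: "\<omega> \<in> S" for \<omega>
  proof (rule convergent_moments.intro)
    note A = scaled_matrix_carrier scaled_matrix_symmetric[OF S_sub[OF \<omega>]]
    have "distribution_function (esd (scaled_matrix a (Suc n) \<omega>))" for n
      using scaled_matrix_carrier[of "Suc n" \<omega>] by (intro distribution_function_esd) simp
    then show "real_distribution (?\<nu> \<omega> n)" for n
      by (rule distribution_function_real_distribution)
    show "integrable (?\<nu> \<omega> n) (\<lambda>x. x ^ k)" for n k
      by (rule esd_integral(1)[OF A]) simp_all
  qed (rule S_lim[OF \<omega>] C m_bound | assumption)+
  have "S \<noteq> {}" using S(2) by auto
  \<comment> \<open>One sample point suffices to produce the law, since the limits m do not depend
    on it.\<close>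
  then obtain \<omega>\<^sub>0 where "\<omega>\<^sub>0 \<in> S" by blast
  then interpret \<nu>: convergent_moments "?\<nu> \<omega>\<^sub>0" m "2 * K" by (rule cm)
  obtain \<mu> where \<mu>: "real_distribution \<mu>" "convergent_moments (\<lambda>_. \<mu>) m (2 * K)"
    by (rule \<nu>.limit_distribution_exists)
  define F where "F = cdf \<mu>"
  have F: "distribution_function F" "interval_measure F = \<mu>"
    unfolding F_def using interval_measure_cdf[OF \<mu>(1)] by auto
  have moments: "(LINT x|\<mu>. x ^ k) = m k" for k
    by (rule LIMSEQ_unique[OF tendsto_const convergent_moments.lim[OF \<mu>(2)]])
  have weak: "(\<lambda>n. LINT x|interval_measure (esd (scaled_matrix a n \<omega>)). f x) \<longlonglongrightarrow> (LINT x|interval_measure F. f x)"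
    if "\<omega> \<in> S" "continuous_on UNIV f" "bounded (range f)" for \<omega> and f :: "real \<Rightarrow> real"
    unfolding F(2)
    by (rule LIMSEQ_imp_Suc, rule moments_imp_weak_convergence[OF that(2,3) cm[OF that(1)] \<mu>(2)])
  show ?thesis
  proof (intro exI[of _ F] conjI allI impI)
    show "distribution_function F" by (rule F)
    show "has_limit_moments \<Lambda> F"
      unfolding has_limit_moments_def F(2)
    proof (intro conjI allI impI)
      show "integrable \<mu> (\<lambda>x. x ^ k)" for k by (rule convergent_moments.moments[OF \<mu>(2)])
      show "(LINT x|\<mu>. x ^ (2 * s)) = even_moment \<Lambda> s" if "s \<ge> 1" for s
        by (rule trans[OF moments m_even[OF that]])
      show "(LINT x|\<mu>. x ^ (2 * s + 1)) = 0" for s by (rule trans[OF moments m_odd])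
    qed
  next
    fix G assume "distribution_function G \<and> has_limit_moments \<Lambda> G"
    then have G: "distribution_function G"
      and G_int: "\<And>k. integrable (interval_measure G) (\<lambda>x. x ^ k)"
      and G_even: "\<And>s. s \<ge> 1 \<Longrightarrow> (LINT x|interval_measure G. x ^ (2 * s)) = even_moment \<Lambda> s"
      and G_odd: "\<And>s. (LINT x|interval_measure G. x ^ (2 * s + 1)) = 0"
      unfolding has_limit_moments_def by blast+
    have dG: "real_distribution (interval_measure G)"
      by (rule distribution_function_real_distribution[OF G])
    have G_moments: "(LINT x|interval_measure G. x ^ k) = m k" for k
    proof (cases "even k")
      case True
      then obtain s where s: "k = 2 * s" by blast
      show ?thesis
      proof (cases "s = 0")
        \<comment> \<open>The zeroth moment is not prescribed by \<open>has_limit_moments\<close>;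
          it is the total mass.\<close>
        case True
        interpret G: real_distribution "interval_measure G" by (rule dG)
        have "(LINT x|interval_measure G. (1 :: real)) = 1" using G.prob_space by simp
        then show ?thesis by (simp add: s True m_0)
      next
        case False
        then have "s \<ge> 1" by simp
        then show ?thesis unfolding s by (simp only: G_even m_even)
      qed
    next
      case False
      then obtain s where s: "k = 2 * s + 1" by (rule oddE)
      show ?thesis unfolding s by (simp only: G_odd m_odd)
    qed
    \<comment> \<open>G enters as a constant sequence, so the weak convergence lemma becomes
      equality of integrals.\<close>
    have "convergent_moments (\<lambda>_. interval_measure G) m (2 * K)"
      by (rule convergent_moments.intro) (simp_all only: dG G_int G_moments C m_bound tendsto_const)
    then have eq: "(LINT x|interval_measure G. f x) = (LINT x|interval_measure F. f x)"
      if "continuous_on UNIV f" "bounded (range f)" for f :: "real \<Rightarrow> real"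
      using LIMSEQ_unique[OF tendsto_const moments_imp_weak_convergence[OF that _ \<mu>(2)]]
      unfolding F(2) by blast
    show "G = F"
    proof (rule ext, rule antisym)
      show "G x \<le> F x" for x by (rule distribution_function_le[OF G F(1) eq])
      show "F x \<le> G x" for x by (rule distribution_function_le[OF F(1) G eq[symmetric]])
    qed
  next
    fix f :: "real \<Rightarrow> real" assume f: "continuous_on UNIV f \<and> bounded (range f)"
    have "AE \<omega> in M. \<omega> \<in> S" using prob_eq_1[OF S(1)] S(2) by blast
    then show "AE \<omega> in M. (\<lambda>n. LINT x|interval_measure (esd (scaled_matrix a n \<omega>)). f x)
        \<longlonglongrightarrow> (LINT x|interval_measure F. f x)"
    proof eventually_elim
      case (elim \<omega>)
      then show ?case using f by (intro weak) simp_all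
    qed
  next
    show "\<exists>S\<in>sets M. prob S = 1 \<and> (\<forall>\<omega>\<in>S. weakly_converges (\<lambda>n. esd (scaled_matrix a n \<omega>)) F)"
    proof (intro bexI[of _ S] conjI ballI)
      show "weakly_converges (\<lambda>n. esd (scaled_matrix a n \<omega>)) F" if "\<omega> \<in> S" for \<omega>
        unfolding weakly_converges_def using weak[OF that] by blast
    qed (rule S)+
  qed
qed

theorem theorem1:
  fixes M :: "'w measure"
    and a :: "nat \<Rightarrow> nat \<Rightarrow> 'w \<Rightarrow> real"
    and \<sigma> \<Lambda> :: "nat \<Rightarrow> real"
    and K :: real
  assumes "prob_space M"
    and "\<And>i. i \<ge> 1 \<Longrightarrow> \<sigma> i > 0"
    and "prob_space.indep_vars M (\<lambda>_. borel) (\<lambda>(i, j). a i j) {(i, j). 1 \<le> i \<and> i \<le> j}"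
    and "\<And>i j \<omega>. i \<ge> 1 \<Longrightarrow> j \<ge> 1 \<Longrightarrow> \<omega> \<in> space M \<Longrightarrow> a j i \<omega> = a i j \<omega>"
    and "\<And>i j. i \<ge> 1 \<Longrightarrow> j \<ge> 1 \<Longrightarrow> prob_space.expectation M (a i j) = 0"
    and "K > 0"
    and "\<And>i j. i \<ge> 1 \<Longrightarrow> j \<ge> 1 \<Longrightarrow> prob_space.prob M {\<omega> \<in> space M. \<bar>a i j \<omega>\<bar> < K} = 1"
    and "\<And>i j. i \<ge> 1 \<Longrightarrow> j \<ge> 1 \<Longrightarrow> prob_space.variance M (a i j) = \<sigma> i * \<sigma> j"
    and "(\<lambda>n. Max (\<sigma> ` {1..n}) / Min (\<sigma> ` {1..n})) \<in> O(\<lambda>n. ln (real n))"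
    and "\<And>k. k \<ge> 1 \<Longrightarrow> (\<lambda>n. (\<Sum>i=1..n. \<sigma> i ^ k) / real n) \<longlonglongrightarrow> \<Lambda> k"
  shows "\<exists>F. distribution_function F \<and> has_limit_moments \<Lambda> F \<and>
    (\<forall>G. distribution_function G \<and> has_limit_moments \<Lambda> G \<longrightarrow> G = F) \<and>
    (\<forall>f :: real \<Rightarrow> real. continuous_on UNIV f \<and> bounded (range f) \<longrightarrow>
      (AE \<omega> in M. (\<lambda>n. LINT x|interval_measure (esd (scaled_matrix a n \<omega>)). f x)
                    \<longlonglongrightarrow> (LINT x|interval_measure F. f x))) \<and>
    (\<exists>S\<in>sets M. prob_space.prob M S = 1 \<and>
      (\<forall>\<omega>\<in>S. weakly_converges (\<lambda>n. esd (scaled_matrix a n \<omega>)) F))"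
proof -
  interpret prob_space M by (rule assms(1))
  interpret bounded_wigner M a \<sigma> \<Lambda> K
    using assms by unfold_locales auto
  show ?thesis by (rule semicircle_type_law)
qed

end
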